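(* Fix a spreading factor $s$ and a tier index $m\in\{1,\dots,M\}$. Under the Poisson rain model, the Laplace transform $\mathcal{L}_{\bar I_s^{(m)}}(z)=\mathbb{E}\{e^{-z\bar I_s^{(m)}}\}$ of the packet-averaged interference $\bar I_s^{(m)}$ received at gateway 0 from all tier-$m$ cells is, for $z>0$, $$\mathcal{L}_{\bar I_s^{(m)}}(z)=\exp\bigg(-\frac{2\lambda \Delta_s |\mathcal{M}_m| E_s^{(m)}(z) }{1-\Delta_s}\bigg),$$ where $|\mathcal{M}_m|$ is the number of gateways in tier $m$ and $$E_s^{(m)}(z)\triangleq \int_{0}^{2\pi}\int_{r_{s-1}}^{r_s} \bigg(1+\frac{1}{z Q_{s}^{(m)}(r,\psi)}\ln\frac{1}{1+z Q_{s}^{(m)}(r,\psi)}\bigg)\, r \,dr\,d\psi,$$ with $$Q_{s}^{(m)}(r,\psi)=P_s^{\rm edge}\alpha_0\bigg(\frac{H_G^2+r^2}{(H_G^2+r_s^2)(H_G^2+D_m^2+r^2-2rD_m\cos\psi)}\bigg)^{n_0/2}.$$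
   Context: Gateways (GWs) all have height $H_G>0$. GW 0 is above the origin of $\mathbb{R}^2$. Tier $m$ is a finite set $\mathcal{M}_m$ of other co-channel GWs, all at the same horizontal distance $D_m>0$ from GW 0, each with its own cell. In every cell, users with spreading factor $s$ lie in the ring of points at horizontal distance $r\in[r_{s-1},r_s]$ from their own GW ($0\le r_{s-1}<r_s$), over all angles. For a user $k$ in the cell of GW $n\in\mathcal{M}_m$, let $r_k$ be its horizontal distance to GW $n$ and $\psi_k$ the (horizontal) angle user $k$–GW $n$–GW 0, so its horizontal distance $d_k$ to GW 0 satisfies $d_k^2=D_m^2+r_k^2-2r_kD_m\cos\psi_k$. Parameters: spatial user density per channel $\lambda>0$, packet duration $T_s>0$, duty cycle $\Delta_s\in[0,1)$, and access rate $\rho_s\triangleq\frac{\Delta_s}{(1-\Delta_s)T_s}$ (number of packet initiations per user per unit time). All cells use the same parameters. Channel and power control: the channel power gain from user $k$ to GW 0 is $\bar g_k\zeta_k$, with $\bar g_k=\alpha_0(H_G^2+d_k^2)^{-n_0/2}$, $\alpha_0>0$, $n_0\ge2$, and $\zeta_k$ i.i.d. exponential of mean 1. The transmit power of a user with spreading factor $s$ at horizontal distance $r_k$ from its own GW is $P_k=P_s^{\rm edge}\big(\frac{H_G^2+r_k^2}{H_G^2+r_s^2}\big)^{n_0/2}$ with $P_s^{\rm edge}>0$. Hence the average interference power received at GW 0 from user $k$ in a tier-$m$ cell is $P_k\bar g_k=Q_s^{(m)}(r_k,\psi_k)$. Poisson rain model: for each GW $n\in\mathcal{M}_m$, the packets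 of spreading factor $s$ sent in its cell are the points $(\mathbf{w}_k,t_k)$ of a homogeneous Poisson point process on (ring around GW $n$) $\times\,\mathbb{R}$ with density $\lambda\rho_s$, a point representing a user at location $\mathbf{w}_k$ transmitting one packet during $[t_k,t_k+T_s)$. The processes of different cells are independent, and the marks $\zeta_k$ are independent of the point processes. Interference: $I_s^{(m)}(t)=\sum_{k:\,t_k\le t<t_k+T_s}Q_s^{(m)}(r_k,\psi_k)\zeta_k$, the sum being over all points of all tier-$m$ cells, and $\bar I_s^{(m)}\triangleq\frac{1}{T_s}\int_0^{T_s}I_s^{(m)}(t)\,dt$, where $[0,T_s]$ is the time interval of the reference packet at GW 0. *)

theory Defs
  imports "HOL-Probability.Probability"
begin

section \<open>Poisson point processes\<close>

text \<open>
  A point process on a Borel space is given by an enumeration of its points: in the outcome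
  \<open>\<omega>\<close> the points, with multiplicity, are \<open>X k \<omega>\<close> for the indices \<open>k\<close> with \<open>enat k < N \<omega>\<close>
  (the values of \<open>X k\<close> at other indices are not points).  The order of the enumeration is
  arbitrary, and \<open>N \<omega>\<close> may be finite or infinite.
\<close>

definition point_count ::
  "('w \<Rightarrow> enat) \<Rightarrow> (nat \<Rightarrow> 'w \<Rightarrow> 'a) \<Rightarrow> 'a set \<Rightarrow> 'w \<Rightarrow> ennreal" where
  "point_count N X B \<omega> = emeasure (count_space UNIV) {k. enat k < N \<omega> \<and> X k \<omega> \<in> B}"

text \<open>
  The counts of sets of infinite intensity are not constrained explicitly: for a sigma-finite
  intensity they are almost surely infinite by the two conditions on the counts below.
\<close>

definition poisson_point_process ::
  "'w measure \<Rightarrow> ('a::topological_space) measure \<Rightarrow> ('w \<Rightarrow> enat) \<Rightarrow> (nat \<Rightarrow> 'w \<Rightarrow> 'a) \<Rightarrow> bool"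
where
  "poisson_point_process M \<Lambda> N X \<longleftrightarrow>
     N \<in> measurable M (count_space UNIV) \<and>
     (\<forall>k. X k \<in> borel_measurable M) \<and>
     (\<forall>B\<in>sets borel. emeasure \<Lambda> B < \<infinity> \<longrightarrow>
        (\<forall>j::nat. measure M {\<omega> \<in> space M. point_count N X B \<omega> = of_nat j}
                   = exp (- measure \<Lambda> B) * measure \<Lambda> B ^ j / fact j)) \<and>
     (\<forall>B::nat \<Rightarrow> 'a set. range B \<subseteq> sets borel \<longrightarrow> disjoint_family B \<longrightarrow>
        prob_space.indep_vars M (\<lambda>_. borel) (\<lambda>i. point_count N X (B i)) UNIV)"

definition homogeneous_intensity :: "('a::euclidean_space) set \<Rightarrow> real \<Rightarrow> 'a measure" where
  "homogeneous_intensity S c = density lborel (\<lambda>x. ennreal c * indicator S x)"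

definition laplace_transform :: "'w measure \<Rightarrow> ('w \<Rightarrow> real) \<Rightarrow> real \<Rightarrow> real" where
  "laplace_transform M Y z = (LINT \<omega>|M. exp (- z * Y \<omega>))"


section \<open>Network, channel and power control\<close>

text \<open>
  Spreading factors and tiers are indexed by natural numbers; users with spreading factor
  \<open>s \<ge> 1\<close> lie at horizontal distance between \<open>ring_radius (s - 1)\<close> and \<open>ring_radius s\<close> from
  their own gateway.  Gateway 0 is above the origin and is not an element of any \<open>tier m\<close>.
\<close>

record 'g network =
  gw_height :: real
  path_const :: real                  \<comment> \<open>\<open>\<alpha>\<^sub>0\<close>\<close>
  path_exp :: real                    \<comment> \<open>\<open>n\<^sub>0\<close>\<close>
  user_density :: real                \<comment> \<open>\<open>\<lambda>\<close>\<close>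
  ring_radius :: "nat \<Rightarrow> real"
  edge_power :: "nat \<Rightarrow> real"
  packet_time :: "nat \<Rightarrow> real"        \<comment> \<open>\<open>T\<^sub>s\<close>\<close>
  duty_cycle :: "nat \<Rightarrow> real"         \<comment> \<open>\<open>\<Delta>\<^sub>s\<close>\<close>
  num_tiers :: nat
  tier :: "nat \<Rightarrow> 'g set"
  tier_dist :: "nat \<Rightarrow> real"          \<comment> \<open>\<open>D\<^sub>m\<close>\<close>
  gw_pos :: "'g \<Rightarrow> real ^ 2"

definition access_rate :: "'g network \<Rightarrow> nat \<Rightarrow> real" where
  "access_rate net s = duty_cycle net s / ((1 - duty_cycle net s) * packet_time net s)"

definition ring :: "'g network \<Rightarrow> nat \<Rightarrow> 'g \<Rightarrow> (real ^ 2) set" where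
  "ring net s n =
     {w. ring_radius net (s - 1) \<le> dist w (gw_pos net n) \<and> dist w (gw_pos net n) \<le> ring_radius net s}"

text \<open>
  The angle at the gateway \<open>n\<close> between the user at \<open>w\<close> and the origin.  For \<open>w\<close> at the
  gateway itself the value (here \<open>arccos 0\<close>) is immaterial.
\<close>

definition user_angle :: "'g network \<Rightarrow> 'g \<Rightarrow> real ^ 2 \<Rightarrow> real" where
  "user_angle net n w =
     arccos (((w - gw_pos net n) \<bullet> (0 - gw_pos net n)) /
             (norm (w - gw_pos net n) * norm (0 - gw_pos net n)))"

definition tx_power :: "'g network \<Rightarrow> nat \<Rightarrow> real \<Rightarrow> real" where
  "tx_power net s r =
     edge_power net s *
       (((gw_height net)\<^sup>2 + r\<^sup>2) / ((gw_height net)\<^sup>2 + (ring_radius net s)\<^sup>2)) powr (path_exp net / 2)"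

definition avg_gain :: "'g network \<Rightarrow> real ^ 2 \<Rightarrow> real" where
  "avg_gain net w = path_const net * ((gw_height net)\<^sup>2 + (norm w)\<^sup>2) powr (- path_exp net / 2)"

definition Q :: "'g network \<Rightarrow> nat \<Rightarrow> nat \<Rightarrow> real \<Rightarrow> real \<Rightarrow> real" where
  "Q net s m r \<psi> =
     edge_power net s * path_const net *
       (((gw_height net)\<^sup>2 + r\<^sup>2) /
         (((gw_height net)\<^sup>2 + (ring_radius net s)\<^sup>2) *
          ((gw_height net)\<^sup>2 + (tier_dist net m)\<^sup>2 + r\<^sup>2 - 2 * r * tier_dist net m * cos \<psi>)))
       powr (path_exp net / 2)"

lemma norm_eq_law_of_cosines:
  assumes "norm (gw_pos net n) = tier_dist net m"
  shows "(norm w)\<^sup>2 = (tier_dist net m)\<^sup>2 + (dist w (gw_pos net n))\<^sup>2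
           - 2 * dist w (gw_pos net n) * tier_dist net m * cos (user_angle net n w)"
proof -
  define c where "c = gw_pos net n"
  define u where "u = w - c"
  have w: "w = u + c" by (simp add: u_def)
  have cos: "norm u * norm c * cos (user_angle net n w) = - (u \<bullet> c)"
  proof (cases "u = 0 \<or> c = 0")
    case True
    then show ?thesis by auto
  next
    case False
    then have pos: "norm u * norm c > 0" by simp
    have "\<bar>u \<bullet> c\<bar> \<le> norm u * norm c" by (rule Cauchy_Schwarz_ineq2)
    then have "\<bar>- (u \<bullet> c) / (norm u * norm c)\<bar> \<le> 1" using pos by (simp add: abs_divide)
    then have "cos (arccos (- (u \<bullet> c) / (norm u * norm c))) = - (u \<bullet> c) / (norm u * norm c)"
      by (rule cos_arccos_abs)
    moreover have "user_angle net n w = arccos (- (u \<bullet> c) / (norm u * norm c))"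
      unfolding user_angle_def c_def[symmetric] u_def[symmetric] by simp
    ultimately show ?thesis using pos False by simp
  qed
  have "(norm w)\<^sup>2 = (norm u)\<^sup>2 + (norm c)\<^sup>2 + 2 * (u \<bullet> c)"
    unfolding w power2_norm_eq_inner by (simp add: inner_add inner_commute)
  then show ?thesis
    using cos assms unfolding c_def[symmetric] dist_norm u_def[symmetric] by (simp add: algebra_simps)
qed

lemma Q_eq_received_power:
  assumes "0 < gw_height net" "norm (gw_pos net n) = tier_dist net m"
  shows "Q net s m (dist w (gw_pos net n)) (user_angle net n w)
           = tx_power net s (dist w (gw_pos net n)) * avg_gain net w"
proof -
  have eq: "(gw_height net)\<^sup>2 + (tier_dist net m)\<^sup>2 + (dist w (gw_pos net n))\<^sup>2
           - 2 * dist w (gw_pos net n) * tier_dist net m * cos (user_angle net n w)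
         = (gw_height net)\<^sup>2 + (norm w)\<^sup>2"
    using norm_eq_law_of_cosines[OF assms(2), of w] by simp
  have pos: "0 < (gw_height net)\<^sup>2 + x\<^sup>2" for x :: real
    using assms(1) by (simp add: add_pos_nonneg)
  have powr: "(a / (b * c)) powr p = (a / b) powr p * c powr - p"
    if "0 < a" "0 < b" "0 < c" for a b c p :: real
    using that by (simp add: powr_divide powr_mult powr_minus divide_simps)
  show ?thesis
    unfolding Q_def tx_power_def avg_gain_def eq powr[OF pos pos pos] by simp
qed


section \<open>Poisson rain and interference\<close>

text \<open>
  \<open>N n\<close> and \<open>X n\<close> enumerate the packets (user location, start time) of the cell of gateway
  \<open>n\<close>, and \<open>\<zeta> n k\<close> is the fading mark of the packet \<open>X n k\<close>.

  Independence of the cells is independence of the families of counts of Borel sets; this is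
  weaker than independence of the enumerations, whose order may be chosen jointly.  The marks
  are independent of all the enumerations.
\<close>

definition poisson_rain ::
  "'w measure \<Rightarrow> 'g network \<Rightarrow> nat \<Rightarrow> nat \<Rightarrow> ('g \<Rightarrow> 'w \<Rightarrow> enat)
     \<Rightarrow> ('g \<Rightarrow> nat \<Rightarrow> 'w \<Rightarrow> (real ^ 2) \<times> real) \<Rightarrow> ('g \<Rightarrow> nat \<Rightarrow> 'w \<Rightarrow> real) \<Rightarrow> bool"
where
  "poisson_rain M net s m N X \<zeta> \<longleftrightarrow>
     (\<forall>n\<in>tier net m.
        poisson_point_process M
          (homogeneous_intensity (ring net s n \<times> UNIV) (user_density net * access_rate net s))
          (N n) (X n)) \<and>
     prob_space.indep_vars M (\<lambda>_. PiM (sets borel) (\<lambda>_. borel))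
       (\<lambda>n \<omega>. \<lambda>B\<in>sets borel. point_count (N n) (X n) B \<omega>) (tier net m) \<and>
     (\<forall>n\<in>tier net m. \<forall>k. distributed M lborel (\<zeta> n k) (exponential_density 1)) \<and>
     prob_space.indep_vars M (\<lambda>_. borel) (\<lambda>(n, k). \<zeta> n k) (tier net m \<times> UNIV) \<and>
     prob_space.indep_set M
       (sets (vimage_algebra (space M)
          (\<lambda>\<omega>. \<lambda>n\<in>tier net m. (N n \<omega>, \<lambda>k. X n k \<omega>))
          (PiM (tier net m) (\<lambda>_. count_space UNIV \<Otimes>\<^sub>M PiM UNIV (\<lambda>_. borel)))))
       (sets (vimage_algebra (space M)
          (\<lambda>\<omega>. \<lambda>(n, k)\<in>tier net m \<times> UNIV. \<zeta> n k \<omega>)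
          (PiM (tier net m \<times> UNIV) (\<lambda>_. borel))))"

text \<open>
  Almost surely the series below have only finitely many nonzero terms.
\<close>

definition interference ::
  "'g network \<Rightarrow> nat \<Rightarrow> nat \<Rightarrow> ('g \<Rightarrow> 'w \<Rightarrow> enat) \<Rightarrow> ('g \<Rightarrow> nat \<Rightarrow> 'w \<Rightarrow> (real ^ 2) \<times> real)
     \<Rightarrow> ('g \<Rightarrow> nat \<Rightarrow> 'w \<Rightarrow> real) \<Rightarrow> real \<Rightarrow> 'w \<Rightarrow> real"
where
  "interference net s m N X \<zeta> t \<omega> =
     (\<Sum>n\<in>tier net m. \<Sum>k.
        let (w, t\<^sub>k) = X n k \<omega> in
        if enat k < N n \<omega> \<and> t\<^sub>k \<le> t \<and> t < t\<^sub>k + packet_time net s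
        then Q net s m (dist w (gw_pos net n)) (user_angle net n w) * \<zeta> n k \<omega>
        else 0)"

definition avg_interference ::
  "'g network \<Rightarrow> nat \<Rightarrow> nat \<Rightarrow> ('g \<Rightarrow> 'w \<Rightarrow> enat) \<Rightarrow> ('g \<Rightarrow> nat \<Rightarrow> 'w \<Rightarrow> (real ^ 2) \<times> real)
     \<Rightarrow> ('g \<Rightarrow> nat \<Rightarrow> 'w \<Rightarrow> real) \<Rightarrow> 'w \<Rightarrow> real"
where
  "avg_interference net s m N X \<zeta> \<omega> =
     1 / packet_time net s * (LBINT t:{0..packet_time net s}. interference net s m N X \<zeta> t \<omega>)"

definition E :: "'g network \<Rightarrow> nat \<Rightarrow> nat \<Rightarrow> real \<Rightarrow> real" where
  "E net s m z =
     (LBINT \<psi>:{0..2 * pi}. LBINT r:{ring_radius net (s - 1)..ring_radius net s}.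
        (1 + 1 / (z * Q net s m r \<psi>) * ln (1 / (1 + z * Q net s m r \<psi>))) * r)"

end

theory Submission
  imports Defs
begin

text \<open>
  Almost surely only finitely many packets meet the reference interval, and averaging over time
  turns the packet started at \<open>t\<close> into the weight \<open>max 0 (1 - \<bar>t\<bar> / T)\<close>.  Integrating out the
  exponential marks replaces the factor of a packet with mean power \<open>q\<close> by
  \<open>1 / (1 + z * q * max 0 (1 - \<bar>t\<bar> / T))\<close>.  What remains is the Laplace functional of independent
  Poisson processes: for a simple function it is a product over the level sets, and monotone
  approximation by simple functions gives the general case.  The exponent is computed by
  integrating first over the start time, which produces the logarithm, and then over the ring in
  polar coordinates whose zero angle points from the gateway to the origin.
\<close>

section \<open>The Laplace functional of Poisson processes\<close>

text \<open>The two independence assumptions live on different levels. Marks are attached to the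
  indices of an enumeration and are independent of the enumerations as a whole, whereas distinct
  cells are independent only through their counts. Hence the marks have to go before the cells are
  separated. Each factor 1/(1 + c) that they leave is written as exp(-ln(1 + c)), so the exponent is
  again a sum over points: it no longer depends on their order and is a limit of expressions in the
  counts, to which the independence of the cells applies. The integrand of the exponent is then 1 -
  exp(-ln(1 + c)) = c/(1 + c). The two halves of the start-time window [-T, T] produce the 2 of the
  formula, together with a factor T that the access rate cancels. All cells contribute equally
  because their gateways have the same distance to the origin; this produces the number of
  gateways.\<close>

lemma (in prob_space)
  fixes C :: "'a \<Rightarrow> ennreal"
  assumes [measurable]: "C \<in> borel_measurable M" and a: "0 \<le> a"
    and dist: "\<And>j::nat. measure M {\<omega> \<in> space M. C \<omega> = of_nat j} = exp (- \<mu>) * \<mu> ^ j / fact j"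
  shows poisson_count_finite: "AE \<omega> in M. C \<omega> < \<infinity>"
    and poisson_count_laplace:
      "(LINT \<omega>|M. exp (- a * enn2real (C \<omega>))) = exp (- (\<mu> * (1 - exp (- a))))"
proof -
  define A where "A j = {\<omega> \<in> space M. C \<omega> = of_nat j}" for j :: nat
  have [measurable]: "A j \<in> events" for j unfolding A_def by measurable
  have disj: "disjoint_family A"
    by (auto simp: disjoint_family_on_def A_def)
  have series: "(\<lambda>j. exp (- \<mu>) * x ^ j / fact j) sums (exp (- \<mu>) * exp x)" for x :: real
    using sums_mult[OF exp_converges[of x], of "exp (- \<mu>)"] by (simp add: field_simps)
  have probA: "prob (A j) = exp (- \<mu>) * \<mu> ^ j / fact j" for j
    unfolding A_def by (rule dist)
  \<comment> \<open>The Poisson weights of the finite values already add up to 1, so no mass is left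
    for the value \<infinity> of \<open>C\<close>.\<close>
  have "(\<lambda>j. prob (A j)) sums prob (\<Union>j. A j)"
    by (intro finite_measure_UNION disj) auto
  moreover have "(\<lambda>j. prob (A j)) sums 1"
    using series[of \<mu>] by (simp add: probA flip: exp_add)
  ultimately have "prob (\<Union>j. A j) = 1" by (rule sums_unique2)
  then have AE: "AE \<omega> in M. \<omega> \<in> (\<Union>j. A j)"
    by (intro AE_prob_1)
  show "AE \<omega> in M. C \<omega> < \<infinity>"
    using AE by eventually_elim (auto simp: A_def less_top[symmetric])
  \<comment> \<open>Expanding by the value of \<open>C\<close>: for almost every outcome exactly one
    \<open>g j\<close> is nonzero, and its integral is the Poisson weight with \<mu> replaced by
    \<mu> * exp (- a), up to normalisation.\<close>
  define g where "g j \<omega> = exp (- a * real j) * indicator (A j) \<omega>" for j \<omega>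
  have g_outside: "g i \<omega> = 0" if "\<omega> \<in> A j" "i \<noteq> j" for i j \<omega>
    using that disj by (auto simp: g_def disjoint_family_on_def indicator_def)
  have int_g: "integrable M (g j)" "integral\<^sup>L M (g j) = exp (- \<mu>) * (\<mu> * exp (- a)) ^ j / fact j" for j
    unfolding g_def by (auto simp: probA power_mult_distrib exp_of_nat_mult[symmetric] mult_ac
        intro!: integrable_real_indicator simp: emeasure_eq_measure)
  have "(LINT \<omega>|M. exp (- a * enn2real (C \<omega>))) = (LINT \<omega>|M. (\<Sum>j. g j \<omega>))"
  proof (rule integral_cong_AE)
    show "AE \<omega> in M. exp (- a * enn2real (C \<omega>)) = (\<Sum>j. g j \<omega>)"
      using AE
    proof eventually_elim
      case (elim \<omega>)
      then obtain j where j: "\<omega> \<in> A j" by auto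
      then have "(\<Sum>i. g i \<omega>) = (\<Sum>i\<in>{j}. g i \<omega>)"
        by (intro suminf_finite) (auto simp: g_outside)
      with j show ?case by (simp add: g_def A_def ennreal_of_nat_eq_real_of_nat)
    qed
  qed (auto simp: g_def)
  also have "\<dots> = (\<Sum>j. integral\<^sup>L M (g j))"
  proof (rule integral_suminf)
    show "AE \<omega> in M. summable (\<lambda>j. norm (g j \<omega>))"
      using AE
    proof eventually_elim
      case (elim \<omega>)
      then obtain j where j: "\<omega> \<in> A j" by auto
      then show ?case by (intro summable_finite[of "{j}"]) (auto simp: g_outside)
    qed
    have "norm (g j \<omega>) = g j \<omega>" for j \<omega> by (simp add: g_def)
    then show "summable (\<lambda>j. LINT \<omega>|M. norm (g j \<omega>))"
      using series[of "\<mu> * exp (- a)"] by (auto simp: int_g sums_iff)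
  qed (rule int_g)
  also have "\<dots> = exp (- \<mu>) * exp (\<mu> * exp (- a))"
    using series[of "\<mu> * exp (- a)"] by (simp add: int_g sums_iff)
  also have "\<dots> = exp (- (\<mu> * (1 - exp (- a))))"
    by (simp add: algebra_simps flip: exp_add)
  finally show "(LINT \<omega>|M. exp (- a * enn2real (C \<omega>))) = exp (- (\<mu> * (1 - exp (- a))))" .
qed

text \<open>A real series along the enumeration. It carries meaning for outcomes with finitely many
  points in the support of \<open>f\<close>, which below are almost all outcomes.\<close>

definition point_sum ::
  "('w \<Rightarrow> enat) \<Rightarrow> (nat \<Rightarrow> 'w \<Rightarrow> 'a) \<Rightarrow> ('a \<Rightarrow> real) \<Rightarrow> 'w \<Rightarrow> real" where
  "point_sum N X f \<omega> = (\<Sum>k. if enat k < N \<omega> then f (X k \<omega>) else 0)"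

text \<open>Written in terms of the counts alone, because the cells are independent only through
  their counts, not through the enumerations of their points.\<close>

definition level_sum :: "('a \<Rightarrow> real) \<Rightarrow> ('a set \<Rightarrow> ennreal) \<Rightarrow> real" where
  "level_sum f c = (\<Sum>y\<in>range f. y * enn2real (c (f -` {y})))"

definition finitely_many_points ::
  "('w \<Rightarrow> enat) \<Rightarrow> (nat \<Rightarrow> 'w \<Rightarrow> 'a) \<Rightarrow> 'a set \<Rightarrow> 'w \<Rightarrow> bool" where
  "finitely_many_points N X A \<omega> \<longleftrightarrow> finite {k. enat k < N \<omega> \<and> X k \<omega> \<in> A}"

lemma point_sum_eq_sum:
  assumes "finitely_many_points N X A \<omega>" "\<And>x. x \<notin> A \<Longrightarrow> f x = 0"
  shows "point_sum N X f \<omega> = (\<Sum>k | enat k < N \<omega> \<and> X k \<omega> \<in> A. f (X k \<omega>))"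
proof -
  have "point_sum N X f \<omega> =
      (\<Sum>k | enat k < N \<omega> \<and> X k \<omega> \<in> A. if enat k < N \<omega> then f (X k \<omega>) else 0)"
    unfolding point_sum_def using assms
    by (intro suminf_finite) (auto simp: finitely_many_points_def)
  then show ?thesis by (simp cong: sum.cong_simp)
qed

text \<open>Grouping the finitely many points in \<open>A\<close> by their value under
  \<open>f\<close> passes between the form in counts, which independence can use, and the form along
  the enumeration, which converges pointwise under approximation of \<open>f\<close>.\<close>

lemma level_sum_point_count:
  assumes fin: "finitely_many_points N X A \<omega>" and A: "\<And>x. x \<notin> A \<Longrightarrow> f x = 0"
    and range: "finite (range f)"
  shows "level_sum f (\<lambda>B. point_count N X B \<omega>) = point_sum N X f \<omega>"
proof -
  define K where "K = {k. enat k < N \<omega> \<and> X k \<omega> \<in> A}"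
  have K: "finite K" using fin by (simp add: K_def finitely_many_points_def)
  have "y * enn2real (point_count N X (f -` {y}) \<omega>) = (\<Sum>k | k \<in> K \<and> f (X k \<omega>) = y. f (X k \<omega>))" for y
  \<comment> \<open>The level 0 may contain infinitely many points; the factor \<open>y\<close>
    disposes of it.\<close>
  proof (cases "y = 0")
    case False
    have *: "{k. enat k < N \<omega> \<and> X k \<omega> \<in> f -` {y}} = {k \<in> K. f (X k \<omega>) = y}"
      using A False by (auto simp: K_def)
    show ?thesis
      unfolding point_count_def * using K
      by (subst emeasure_count_space_finite) (auto simp: ennreal_of_nat_eq_real_of_nat mult.commute)
  qed simp
  then have "level_sum f (\<lambda>B. point_count N X B \<omega>)
      = (\<Sum>y\<in>range f. \<Sum>k | k \<in> K \<and> f (X k \<omega>) = y. f (X k \<omega>))"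
    by (simp add: level_sum_def del: sum_constant)
  also have "\<dots> = (\<Sum>k\<in>K. f (X k \<omega>))"
    by (rule sum.group) (use K range in auto)
  finally show ?thesis
    by (simp add: point_sum_eq_sum[OF fin A] K_def)
qed

lemma level_sum_nonneg: "(\<And>x. 0 \<le> f x) \<Longrightarrow> 0 \<le> level_sum f c"
  unfolding level_sum_def by (auto intro!: sum_nonneg)

context prob_space
begin

text \<open>Independence of a sequence of counts contains their measurability, so it is enough to
  place \<open>B\<close> in the disjoint sequence \<open>B\<close>, {}, {}, ...\<close>

lemma point_count_measurable:
  assumes "poisson_point_process M \<Lambda> N X" and [measurable]: "B \<in> sets borel"
  shows "point_count N X B \<in> borel_measurable M"
proof -
  have "disjoint_family (\<lambda>i::nat. if i = 0 then B else {})"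
    by (auto simp: disjoint_family_on_def)
  then have "indep_vars (\<lambda>_. borel)
      (\<lambda>i. point_count N X ((\<lambda>i::nat. if i = 0 then B else {}) i)) UNIV"
    using assms unfolding poisson_point_process_def by (auto simp: image_subset_iff)
  then have "point_count N X ((\<lambda>i::nat. if i = 0 then B else {}) 0) \<in> borel_measurable M"
    unfolding indep_vars_def by blast
  then show ?thesis by simp
qed

lemma AE_finitely_many_points:
  assumes P: "poisson_point_process M \<Lambda> N X" and B: "B \<in> sets borel" "emeasure \<Lambda> B < \<infinity>"
  shows "AE \<omega> in M. finitely_many_points N X B \<omega>"
proof -
  have "AE \<omega> in M. point_count N X B \<omega> < \<infinity>"
    using P B
    by (intro poisson_count_finite[where \<mu> = "measure \<Lambda> B" and a = 0] point_count_measurable[OF P])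
       (auto simp: poisson_point_process_def)
  then show ?thesis
    by eventually_elim (auto simp: point_count_def finitely_many_points_def emeasure_count_space split: if_splits)
qed

lemma point_sum_measurable:
  assumes "poisson_point_process M \<Lambda> N X" and [measurable]: "f \<in> borel_measurable borel"
  shows "point_sum N X f \<in> borel_measurable M"
proof -
  have [measurable]: "N \<in> measurable M (count_space UNIV)" "\<And>k. X k \<in> borel_measurable M"
    using assms by (auto simp: poisson_point_process_def)
  show ?thesis unfolding point_sum_def by measurable
qed

lemma level_sum_measurable:
  assumes P: "poisson_point_process M \<Lambda> N X" and f: "simple_function borel f"
  shows "(\<lambda>\<omega>. level_sum f (\<lambda>B. point_count N X B \<omega>)) \<in> borel_measurable M"
proof -
  have [measurable]: "point_count N X (f -` {y}) \<in> borel_measurable M" for y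
    using simple_functionD(2)[OF f, of "{y}"] by (intro point_count_measurable[OF P]) auto
  show ?thesis unfolding level_sum_def by measurable
qed

lemma laplace_simple:
  assumes P: "poisson_point_process M \<Lambda> N X" and sets: "sets \<Lambda> = sets borel"
    and f: "simple_function borel f" and nn: "\<And>x. 0 \<le> f x"
    and fin: "emeasure \<Lambda> {x. f x \<noteq> 0} < \<infinity>"
  shows "(LINT \<omega>|M. exp (- level_sum f (\<lambda>B. point_count N X B \<omega>)))
       = exp (- (LINT x|\<Lambda>. 1 - exp (- f x)))"
proof -
  have range: "finite (range f)" using simple_functionD(1)[OF f] by simp
  have B: "f -` {y} \<in> sets borel" for y using simple_functionD(2)[OF f, of "{y}"] by simp
  have B0: "{x. f x \<noteq> 0} \<in> sets borel"
    using simple_functionD(2)[OF f, of "- {0}"] by (simp add: vimage_def)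
  define c where "c y \<omega> = exp (- y * enn2real (point_count N X (f -` {y}) \<omega>))" for y \<omega>
  have finB: "emeasure \<Lambda> (f -` {y}) < \<infinity>" if "y \<noteq> 0" for y
  proof -
    have "emeasure \<Lambda> (f -` {y}) \<le> emeasure \<Lambda> {x. f x \<noteq> 0}"
      using that B0 by (intro emeasure_mono) (auto simp: sets)
    then show ?thesis using fin by (rule le_less_trans)
  qed
  have each: "(LINT \<omega>|M. c y \<omega>) = exp (- ((1 - exp (- y)) * measure \<Lambda> (f -` {y})))" if "y \<in> range f" for y
  \<comment> \<open>The level 0 may have infinite intensity, so that its count has no Poisson law to
    use; its factor is the constant 1.\<close>
  proof (cases "y = 0")
    case True then show ?thesis by (simp add: c_def prob_space)
  next
    case False
    have "(LINT \<omega>|M. c y \<omega>) = exp (- (measure \<Lambda> (f -` {y}) * (1 - exp (- y))))"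
      unfolding c_def using P B finB[OF False] nn that
      by (intro poisson_count_laplace point_count_measurable[OF P])
         (auto simp: poisson_point_process_def)
    then show ?thesis by (simp add: mult.commute)
  qed
  \<comment> \<open>\<open>poisson_point_process\<close> gives independence for sequences of sets, so the levels are numbered.\<close>
  obtain e :: "real \<Rightarrow> nat" where e: "inj_on e (range f)"
    using finite_imp_inj_to_nat_seg[OF range] by auto
  \<comment> \<open>Numbers that label no level receive the empty set, which keeps the whole
    sequence disjoint.\<close>
  define D where "D i = (if i \<in> e ` range f then f -` {the_inv_into (range f) e i} else {})" for i
  define d where "d i x = exp (- the_inv_into (range f) e i * enn2real x)" for i and x :: ennreal
  have De: "D (e y) = f -` {y}" if "y \<in> range f" for y
    using that e by (simp add: D_def the_inv_into_f_f)
  have "disjoint_family D"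
  proof (clarsimp simp: disjoint_family_on_def)
    fix i j :: nat assume "i \<noteq> j"
    then show "D i \<inter> D j = {}"
      using e by (auto simp: D_def the_inv_into_f_f split: if_splits)
  qed
  then have "indep_vars (\<lambda>_. borel) (\<lambda>i. point_count N X (D i)) UNIV"
    using P B unfolding poisson_point_process_def D_def by (auto simp: image_subset_iff)
  then have "indep_vars (\<lambda>_. borel) (\<lambda>i. point_count N X (D i)) (e ` range f)"
    by (rule indep_vars_subset) simp
  then have indep: "indep_vars (\<lambda>_. borel) (\<lambda>i \<omega>. d i (point_count N X (D i) \<omega>)) (e ` range f)"
    unfolding d_def by (rule indep_vars_compose2) simp
  have dc: "d (e y) (point_count N X (D (e y)) \<omega>) = c y \<omega>" if "y \<in> range f" for y \<omega>
    using that e by (simp add: d_def c_def De the_inv_into_f_f)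
  have cM: "c y \<in> borel_measurable M" for y
    unfolding c_def using point_count_measurable[OF P B] by measurable
  have cint: "integrable M (c y)" if "y \<in> range f" for y
    using nn that by (intro integrable_const_bound[where B = 1] cM) (auto simp: c_def)
  have "(LINT \<omega>|M. exp (- level_sum f (\<lambda>B. point_count N X B \<omega>))) = (LINT \<omega>|M. (\<Prod>y\<in>range f. c y \<omega>))"
    by (simp add: level_sum_def c_def exp_sum range flip: sum_negf)
  also have "\<dots> = (\<Prod>y\<in>range f. LINT \<omega>|M. c y \<omega>)"
  proof -
    have "(LINT \<omega>|M. (\<Prod>i\<in>e ` range f. d i (point_count N X (D i) \<omega>)))
        = (\<Prod>i\<in>e ` range f. LINT \<omega>|M. d i (point_count N X (D i) \<omega>))"
      using range cint by (intro indep_vars_lebesgue_integral indep) (auto simp: dc)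
    then show ?thesis by (simp add: prod.reindex[OF e] dc)
  qed
  also have "\<dots> = exp (- (\<Sum>y\<in>range f. (1 - exp (- y)) * measure \<Lambda> (f -` {y})))"
    by (simp add: each exp_sum range flip: sum_negf)
  also have "(\<Sum>y\<in>range f. (1 - exp (- y)) * measure \<Lambda> (f -` {y}))
      = (LINT x|\<Lambda>. (\<Sum>y\<in>range f. (1 - exp (- y)) * indicator (f -` {y}) x))"
  proof -
    have sp: "space \<Lambda> = UNIV" using sets_eq_imp_space_eq[OF sets] by simp
    have "integrable \<Lambda> (\<lambda>x. (1 - exp (- y)) * indicator (f -` {y}) x)" for y
      using B finB[of y] by (cases "y = 0") (auto simp: sets)
    then show ?thesis by (subst Bochner_Integration.integral_sum) (auto simp: sp)
  qed
  also have "(\<lambda>x. (\<Sum>y\<in>range f. (1 - exp (- y)) * indicator (f -` {y}) x)) = (\<lambda>x. 1 - exp (- f x))"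
  proof
    fix x
    have "(\<Sum>y\<in>range f. (1 - exp (- y)) * indicator (f -` {y}) x)
        = (\<Sum>y\<in>range f. if y = f x then 1 - exp (- y) else 0)"
      by (intro sum.cong) auto
    then show "(\<Sum>y\<in>range f. (1 - exp (- y)) * indicator (f -` {y}) x) = 1 - exp (- f x)"
      using range by simp
  qed
  finally show ?thesis .
qed

text \<open>Independence of the cells enters for simple functions, whose sums are measurable
  functions of finitely many counts. The sums of \<phi> along the enumerations are reached from
  there by an almost sure limit, and both sides pass to the limit by dominated convergence.\<close>

theorem laplace_independent_poisson:
  fixes X :: "'i \<Rightarrow> nat \<Rightarrow> 'a \<Rightarrow> 'b::topological_space"
  assumes I: "finite I"
    and P: "\<And>n. n \<in> I \<Longrightarrow> poisson_point_process M (\<Lambda> n) (N n) (X n)"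
    and sets: "\<And>n. n \<in> I \<Longrightarrow> sets (\<Lambda> n) = sets borel"
    and indep: "indep_vars (\<lambda>_. PiM (sets borel) (\<lambda>_. borel))
          (\<lambda>n \<omega>. \<lambda>B\<in>sets borel. point_count (N n) (X n) B \<omega>) I"
    and \<phi>: "\<And>n. n \<in> I \<Longrightarrow> \<phi> n \<in> borel_measurable borel" and nn: "\<And>n x. 0 \<le> \<phi> n x"
    and fin: "\<And>n. n \<in> I \<Longrightarrow> emeasure (\<Lambda> n) {x. \<phi> n x \<noteq> 0} < \<infinity>"
  shows "(LINT \<omega>|M. exp (- (\<Sum>n\<in>I. point_sum (N n) (X n) (\<phi> n) \<omega>)))
       = exp (- (\<Sum>n\<in>I. LINT x|\<Lambda> n. 1 - exp (- \<phi> n x)))"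
proof -
  have "\<exists>f. \<forall>n\<in>I. (\<forall>j. simple_function borel (f n j)) \<and> (\<forall>j x. 0 \<le> f n j x \<and> f n j x \<le> \<phi> n x)
        \<and> (\<forall>x. (\<lambda>j. f n j x) \<longlonglongrightarrow> \<phi> n x)"
  proof (rule bchoice, rule ballI)
    fix n assume "n \<in> I"
    from borel_measurable_implies_simple_function_sequence_real[OF \<phi>[OF this] nn]
    obtain f where f: "incseq f" "\<And>j. simple_function borel (f j)" "\<And>x. bdd_above (range (\<lambda>j. f j x))"
      "\<And>j x. 0 \<le> f j x" "\<phi> n = (SUP j. f j)" by blast
    have eq: "\<phi> n x = (SUP j. f j x)" for x
      by (simp add: f(5) image_image)
    have "f j x \<le> \<phi> n x" for j x
      unfolding eq by (intro cSUP_upper f) simp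
    moreover have "(\<lambda>j. f j x) \<longlonglongrightarrow> \<phi> n x" for x
      unfolding eq using f(1,3) by (intro LIMSEQ_incseq_SUP) (auto simp: incseq_def le_fun_def)
    ultimately show "\<exists>f. (\<forall>j. simple_function borel (f j)) \<and> (\<forall>j x. 0 \<le> f j x \<and> f j x \<le> \<phi> n x)
        \<and> (\<forall>x. (\<lambda>j. f j x) \<longlonglongrightarrow> \<phi> n x)"
      using f by blast
  qed
  then obtain f where f: "\<And>n j. n \<in> I \<Longrightarrow> simple_function borel (f n j)"
      "\<And>n j x. n \<in> I \<Longrightarrow> 0 \<le> f n j x" "\<And>n j x. n \<in> I \<Longrightarrow> f n j x \<le> \<phi> n x"
      "\<And>n x. n \<in> I \<Longrightarrow> (\<lambda>j. f n j x) \<longlonglongrightarrow> \<phi> n x" by blast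
  define A where "A n = {x. \<phi> n x \<noteq> 0}" for n
  have A: "A n \<in> sets borel" if "n \<in> I" for n
    unfolding A_def using \<phi>[OF that] by simp
  \<comment> \<open>The approximants lie between 0 and \<phi>, so all of them vanish off the support
    of \<phi>; one almost sure event of finitely many points therefore serves every
    \<open>j\<close>.\<close>
  have f0: "f n j x = 0" if "n \<in> I" "x \<notin> A n" for n j x
    using f(2,3)[OF that(1), of j x] that by (auto simp: A_def)
  define S where "S n j \<omega> = level_sum (f n j) (\<lambda>B. point_count (N n) (X n) B \<omega>)" for n j \<omega>
  have S_meas: "S n j \<in> borel_measurable M" if "n \<in> I" for n j
    unfolding S_def using level_sum_measurable[OF P f(1)] that by blast
  have S_nn: "0 \<le> S n j \<omega>" if "n \<in> I" for n j \<omega>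
    unfolding S_def by (rule level_sum_nonneg) (use f(2) that in auto)
  have simple: "(LINT \<omega>|M. exp (- (\<Sum>n\<in>I. S n j \<omega>))) = exp (- (\<Sum>n\<in>I. LINT x|\<Lambda> n. 1 - exp (- f n j x)))" for j
  proof -
    have "indep_vars (\<lambda>_. borel) (\<lambda>n \<omega>. exp (- level_sum (f n j)
        (\<lambda>B\<in>sets borel. point_count (N n) (X n) B \<omega>))) I"
    proof (rule indep_vars_compose2[OF indep])
      fix n assume n: "n \<in> I"
      have [measurable]: "(\<lambda>c. c (f n j -` {y})) \<in> borel_measurable (PiM (sets borel) (\<lambda>_. borel))" for y
        using simple_functionD(2)[OF f(1)[OF n], of j "{y}"] by (intro measurable_component_singleton) simp
      show "(\<lambda>c. exp (- level_sum (f n j) c)) \<in> borel_measurable (PiM (sets borel) (\<lambda>_. borel))"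
        unfolding level_sum_def by measurable
    qed
    \<comment> \<open>The level sets are Borel, so restricting the family of counts to Borel sets
      does not affect the level sum.\<close>
    moreover have "level_sum (f n j) (\<lambda>B\<in>sets borel. point_count (N n) (X n) B \<omega>) = S n j \<omega>" if "n \<in> I" for n \<omega>
      unfolding S_def level_sum_def
      using simple_functionD(2)[OF f(1)[OF that], of j] by (intro sum.cong) auto
    ultimately have ind: "indep_vars (\<lambda>_. borel) (\<lambda>n \<omega>. exp (- S n j \<omega>)) I"
      by (subst indep_vars_cong[OF refl _ refl]) auto
    have "(LINT \<omega>|M. exp (- (\<Sum>n\<in>I. S n j \<omega>))) = (LINT \<omega>|M. (\<Prod>n\<in>I. exp (- S n j \<omega>)))"
      by (simp add: exp_sum I flip: sum_negf)
    also have "\<dots> = (\<Prod>n\<in>I. LINT \<omega>|M. exp (- S n j \<omega>))"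
    proof (rule indep_vars_lebesgue_integral[OF I ind])
      fix n assume "n \<in> I"
      then show "integrable M (\<lambda>\<omega>. exp (- S n j \<omega>))"
        using S_nn S_meas by (intro integrable_const_bound[where B = 1]) auto
    qed
    also have "\<dots> = (\<Prod>n\<in>I. exp (- (LINT x|\<Lambda> n. 1 - exp (- f n j x))))"
    proof (rule prod.cong[OF refl])
      fix n assume n: "n \<in> I"
      have "emeasure (\<Lambda> n) {x. f n j x \<noteq> 0} \<le> emeasure (\<Lambda> n) (A n)"
        using f0[OF n] A[OF n] by (intro emeasure_mono) (auto simp: sets[OF n])
      then have "emeasure (\<Lambda> n) {x. f n j x \<noteq> 0} < \<infinity>"
        using fin[OF n] unfolding A_def by (rule le_less_trans)
      then show "(LINT \<omega>|M. exp (- S n j \<omega>)) = exp (- (LINT x|\<Lambda> n. 1 - exp (- f n j x)))"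
        unfolding S_def using n by (intro laplace_simple P sets f) auto
    qed
    also have "\<dots> = exp (- (\<Sum>n\<in>I. LINT x|\<Lambda> n. 1 - exp (- f n j x)))"
      by (simp add: exp_sum I flip: sum_negf)
    finally show ?thesis .
  qed
  have "AE \<omega> in M. \<forall>n\<in>I. finitely_many_points (N n) (X n) (A n) \<omega>"
    using I A fin by (intro AE_finite_allI AE_finitely_many_points[OF P]) (auto simp: A_def)
  then have conv: "AE \<omega> in M. (\<lambda>j. exp (- (\<Sum>n\<in>I. S n j \<omega>)))
      \<longlonglongrightarrow> exp (- (\<Sum>n\<in>I. point_sum (N n) (X n) (\<phi> n) \<omega>))"
  proof eventually_elim
    case (elim \<omega>)
    have "(\<lambda>j. S n j \<omega>) \<longlonglongrightarrow> point_sum (N n) (X n) (\<phi> n) \<omega>" if n: "n \<in> I" for n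
    proof -
      have F: "finitely_many_points (N n) (X n) (A n) \<omega>" using elim n by blast
      have "S n j \<omega> = (\<Sum>k | enat k < N n \<omega> \<and> X n k \<omega> \<in> A n. f n j (X n k \<omega>))" for j
        unfolding S_def using simple_functionD(1)[OF f(1)[OF n], of j]
        by (subst level_sum_point_count[OF F f0[OF n]])
           (auto simp: point_sum_eq_sum[OF F f0[OF n]])
      moreover have "point_sum (N n) (X n) (\<phi> n) \<omega> = (\<Sum>k | enat k < N n \<omega> \<and> X n k \<omega> \<in> A n. \<phi> n (X n k \<omega>))"
        by (rule point_sum_eq_sum[OF F]) (simp add: A_def)
      ultimately show ?thesis
        using f(4)[OF n] by (simp add: tendsto_sum)
    qed
    then show ?case by (intro tendsto_intros)
  qed
  have "(\<lambda>j. LINT \<omega>|M. exp (- (\<Sum>n\<in>I. S n j \<omega>)))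
      \<longlonglongrightarrow> (LINT \<omega>|M. exp (- (\<Sum>n\<in>I. point_sum (N n) (X n) (\<phi> n) \<omega>)))"
  proof (rule integral_dominated_convergence[OF _ _ _ conv])
    have [measurable]: "point_sum (N n) (X n) (\<phi> n) \<in> borel_measurable M" if "n \<in> I" for n
      using point_sum_measurable[OF P \<phi>] that by blast
    show "(\<lambda>\<omega>. exp (- (\<Sum>n\<in>I. point_sum (N n) (X n) (\<phi> n) \<omega>))) \<in> borel_measurable M"
      by measurable
    show "(\<lambda>\<omega>. exp (- (\<Sum>n\<in>I. S n j \<omega>))) \<in> borel_measurable M" for j
      using S_meas by measurable
    show "integrable M (\<lambda>_. 1::real)" by simp
    show "AE \<omega> in M. norm (exp (- (\<Sum>n\<in>I. S n j \<omega>))) \<le> 1" for j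
      using S_nn by (auto intro!: sum_nonneg)
  qed
  moreover have "(\<lambda>j. exp (- (\<Sum>n\<in>I. LINT x|\<Lambda> n. 1 - exp (- f n j x))))
      \<longlonglongrightarrow> exp (- (\<Sum>n\<in>I. LINT x|\<Lambda> n. 1 - exp (- \<phi> n x)))"
  proof (intro tendsto_intros)
    fix n assume n: "n \<in> I"
    have [measurable]: "f n j \<in> borel_measurable (\<Lambda> n)" "\<phi> n \<in> borel_measurable (\<Lambda> n)" for j
      using borel_measurable_simple_function[OF f(1)[OF n]] \<phi>[OF n]
      by (auto simp: measurable_cong_sets[OF sets[OF n] refl])
    show "(\<lambda>j. LINT x|\<Lambda> n. 1 - exp (- f n j x)) \<longlonglongrightarrow> (LINT x|\<Lambda> n. 1 - exp (- \<phi> n x))"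
    \<comment> \<open>Since 0 \<le> 1 - exp(-f) \<le> 1 and f vanishes off \<open>A n\<close>, the
      indicator of \<open>A n\<close> dominates; it is integrable because the support has finite
      intensity.\<close>
    proof (rule integral_dominated_convergence[where w = "indicator (A n)"])
      show "integrable (\<Lambda> n) (indicator (A n) :: _ \<Rightarrow> real)"
        using A[OF n] fin[OF n] by (auto simp: sets[OF n] A_def)
      show "AE x in \<Lambda> n. (\<lambda>j. 1 - exp (- f n j x)) \<longlonglongrightarrow> 1 - exp (- \<phi> n x)"
        by (intro AE_I2 tendsto_intros f n)
      show "AE x in \<Lambda> n. norm (1 - exp (- f n j x)) \<le> indicator (A n) x" for j
        using f0[OF n] f(2)[OF n] by (auto simp: indicator_def)
    qed measurable
  qed
  ultimately show ?thesis unfolding simple by (rule LIMSEQ_unique)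
qed

end

section \<open>Exponential marks\<close>

lemma integral_exponential_density:
  assumes l: "0 < l"
  shows "(LINT x|lborel. exponential_density l x) = 1"
proof -
  interpret D: prob_space "density lborel (exponential_density l)"
    by (rule prob_space_exponential_density[OF l])
  have "(LINT x|density lborel (exponential_density l). (1::real)) = (LINT x|lborel. exponential_density l x *\<^sub>R 1)"
    using l by (intro integral_density) (auto simp: exponential_density_nonneg)
  then show ?thesis using D.prob_space by simp
qed

context prob_space
begin

text \<open>Tilting the unit exponential density by exp(-cx) gives 1/(1 + c) times the exponential
  density of rate 1 + c, whose total mass is 1.\<close>

lemma exponential_distributed_laplace:
  assumes D: "distributed M lborel Z (exponential_density 1)" and c: "0 \<le> c"
  shows "(LINT \<omega>|M. exp (- (c * Z \<omega>))) = 1 / (1 + c)"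
proof -
  have "(LINT \<omega>|M. exp (- (c * Z \<omega>))) = (LINT x|lborel. exponential_density 1 x * exp (- (c * x)))"
    by (rule distributed_integral[OF D, symmetric]) (auto simp: exponential_density_nonneg)
  also have "\<dots> = (LINT x|lborel. 1 / (1 + c) * exponential_density (1 + c) x)"
  proof (rule Bochner_Integration.integral_cong[OF refl])
    fix x :: real
    have "exp (- x) * exp (- (c * x)) = exp (- x * (1 + c))"
      by (simp add: algebra_simps flip: exp_add)
    then show "exponential_density 1 x * exp (- (c * x)) = 1 / (1 + c) * exponential_density (1 + c) x"
      using c by (simp add: exponential_density_def)
  qed
  also have "\<dots> = 1 / (1 + c)"
    using c integral_exponential_density[of "1 + c"] by simp
  finally show ?thesis .
qed

lemma exponential_distributed_AE_nonneg:
  assumes D: "distributed M lborel Z (exponential_density 1)"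
  shows "AE \<omega> in M. 0 \<le> Z \<omega>"
proof -
  have [measurable]: "Z \<in> borel_measurable M"
    using distributed_measurable[OF D] by simp
  have "prob {\<omega> \<in> space M. Z \<omega> \<le> 0} = 0"
    using exponential_distributedD_le[OF D, of 0] by simp
  then have "AE \<omega> in M. \<not> Z \<omega> \<le> 0"
    by (subst (asm) prob_eq_0) auto
  then show ?thesis by eventually_elim simp
qed

text \<open>Rectangles determine the product of two sigma-finite measures, and independence of the
  generated sigma-algebras is multiplicativity on rectangles. The product form is what admits Fubini
  with \<open>U\<close> held fixed.\<close>

lemma indep_set_pair_distr:
  assumes U[measurable]: "U \<in> measurable M S" and V[measurable]: "V \<in> measurable M S'"
    and indep: "indep_set (sets (vimage_algebra (space M) U S)) (sets (vimage_algebra (space M) V S'))"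
  shows "distr M S U \<Otimes>\<^sub>M distr M S' V = distr M (S \<Otimes>\<^sub>M S') (\<lambda>\<omega>. (U \<omega>, V \<omega>))"
proof (rule pair_measure_eqI)
  interpret PU: prob_space "distr M S U" by (rule prob_space_distr[OF U])
  interpret PV: prob_space "distr M S' V" by (rule prob_space_distr[OF V])
  show "sigma_finite_measure (distr M S U)" "sigma_finite_measure (distr M S' V)" ..
  show "sets (distr M S U \<Otimes>\<^sub>M distr M S' V) = sets (distr M (S \<Otimes>\<^sub>M S') (\<lambda>\<omega>. (U \<omega>, V \<omega>)))"
    by (simp cong: sets_pair_measure_cong)
  fix A B assume "A \<in> sets (distr M S U)" "B \<in> sets (distr M S' V)"
  then have AB[measurable]: "A \<in> sets S" "B \<in> sets S'" by auto
  have pre: "(\<lambda>\<omega>. (U \<omega>, V \<omega>)) -` (A \<times> B) \<inter> space M = (U -` A \<inter> space M) \<inter> (V -` B \<inter> space M)"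
    by auto
  have "prob ((U -` A \<inter> space M) \<inter> (V -` B \<inter> space M)) = prob (U -` A \<inter> space M) * prob (V -` B \<inter> space M)"
    by (intro indep_setD[OF indep] in_vimage_algebra AB)
  then show "emeasure (distr M S U) A * emeasure (distr M S' V) B
      = emeasure (distr M (S \<Otimes>\<^sub>M S') (\<lambda>\<omega>. (U \<omega>, V \<omega>))) (A \<times> B)"
    by (subst (1 2 3) emeasure_distr) (auto simp: pre emeasure_eq_measure ennreal_mult)
qed

text \<open>\<open>U\<close> stands for the randomness of the points, \<open>V\<close> for that of
  all marks. Their joint law is a product, so the marks can be integrated with the weights
  \<open>c i u\<close> frozen; the independence of the marks then factorises the inner
  integral.\<close>

lemma laplace_exponential_marks:
  fixes \<zeta> :: "'i \<Rightarrow> 'a \<Rightarrow> real" and c :: "'i \<Rightarrow> 'u \<Rightarrow> real"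
  assumes J: "finite J" "J \<subseteq> L"
    and U[measurable]: "U \<in> measurable M S"
    and UV: "indep_set (sets (vimage_algebra (space M) U S))
       (sets (vimage_algebra (space M) (\<lambda>\<omega>. \<lambda>i\<in>L. \<zeta> i \<omega>) (PiM L (\<lambda>_. borel))))"
    and c[measurable]: "\<And>i. i \<in> J \<Longrightarrow> c i \<in> borel_measurable S" and c_nn: "\<And>i u. 0 \<le> c i u"
    and D: "\<And>i. i \<in> J \<Longrightarrow> distributed M lborel (\<zeta> i) (exponential_density 1)"
    and indep: "indep_vars (\<lambda>_. borel) \<zeta> L"
  shows "(LINT \<omega>|M. exp (- (\<Sum>i\<in>J. c i (U \<omega>) * \<zeta> i \<omega>))) = (LINT \<omega>|M. (\<Prod>i\<in>J. 1 / (1 + c i (U \<omega>))))"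
proof -
  define V where "V \<omega> = (\<lambda>i\<in>L. \<zeta> i \<omega>)" for \<omega>
  \<comment> \<open>The cut-off makes the integrand bounded on the whole product space, not only almost everywhere.\<close>
  define F where "F u v = exp (- (\<Sum>i\<in>J. c i u * max 0 (v i)))" for u and v :: "'i \<Rightarrow> real"
  have V[measurable]: "V \<in> measurable M (PiM L (\<lambda>_. borel))"
    using indep unfolding indep_vars_def V_def[abs_def] by (intro measurable_restrict) auto
  have \<zeta>[measurable]: "\<zeta> i \<in> borel_measurable M" if "i \<in> J" for i
    using distributed_measurable[OF D[OF that]] by simp
  have Fm[measurable]: "(\<lambda>(u, v). F u v) \<in> borel_measurable (S \<Otimes>\<^sub>M PiM L (\<lambda>_. borel))"
  proof -
    have "(\<lambda>p. snd p i) \<in> borel_measurable (S \<Otimes>\<^sub>M PiM L (\<lambda>_. borel))"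
      if "i \<in> J" for i
      using that J by (intro measurable_compose[OF measurable_snd] measurable_component_singleton) auto
    moreover have "(\<lambda>p. c i (fst p)) \<in> borel_measurable (S \<Otimes>\<^sub>M PiM L (\<lambda>_. borel))" if "i \<in> J" for i
      using c[OF that] by (intro measurable_compose[OF measurable_fst])
    ultimately show ?thesis
      unfolding F_def case_prod_beta'
      by (intro borel_measurable_exp borel_measurable_uminus borel_measurable_sum borel_measurable_times
          borel_measurable_max borel_measurable_const measurable_compose[OF _ borel_measurable_exp]) auto
  qed
  have F_bound: "\<bar>F u v\<bar> \<le> 1" for u v
    unfolding F_def using c_nn by (auto intro!: sum_nonneg)
  have AE_nn: "AE \<omega> in M. \<forall>i\<in>J. 0 \<le> \<zeta> i \<omega>"
    using D by (intro AE_finite_allI J exponential_distributed_AE_nonneg)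
  have VJ: "V \<omega> i = \<zeta> i \<omega>" if "i \<in> J" for i \<omega>
    using that J by (auto simp: V_def)
  interpret PU: prob_space "distr M S U" by (rule prob_space_distr[OF U])
  interpret PV: prob_space "distr M (PiM L (\<lambda>_. borel)) V" by (rule prob_space_distr[OF V])
  interpret PP: pair_prob_space "distr M S U" "distr M (PiM L (\<lambda>_. borel)) V" ..
  have joint: "distr M S U \<Otimes>\<^sub>M distr M (PiM L (\<lambda>_. borel)) V
      = distr M (S \<Otimes>\<^sub>M PiM L (\<lambda>_. borel)) (\<lambda>\<omega>. (U \<omega>, V \<omega>))"
    by (rule indep_set_pair_distr[OF U V]) (use UV in \<open>simp add: V_def[abs_def]\<close>)
  \<comment> \<open>The inner integral for a fixed value \<open>u\<close> of \<open>U\<close>: here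
    the weights are constants, and one exponential Laplace transform per mark remains.\<close>
  have Fu: "(LINT \<omega>|M. F u (V \<omega>)) = (\<Prod>i\<in>J. 1 / (1 + c i u))" for u
  proof -
    have "(LINT \<omega>|M. F u (V \<omega>)) = (LINT \<omega>|M. (\<Prod>i\<in>J. exp (- (c i u * max 0 (\<zeta> i \<omega>)))))"
      unfolding F_def by (simp add: VJ J exp_sum flip: sum_negf cong: sum.cong prod.cong)
    also have "\<dots> = (\<Prod>i\<in>J. LINT \<omega>|M. exp (- (c i u * max 0 (\<zeta> i \<omega>))))"
    proof (rule indep_vars_lebesgue_integral[OF J(1)])
      show "indep_vars (\<lambda>_. borel) (\<lambda>i \<omega>. exp (- (c i u * max 0 (\<zeta> i \<omega>)))) J"
        by (rule indep_vars_compose2[OF indep_vars_subset[OF indep J(2)]]) measurable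
      show "integrable M (\<lambda>\<omega>. exp (- (c i u * max 0 (\<zeta> i \<omega>))))" if "i \<in> J" for i
        using that c_nn by (intro integrable_const_bound[where B = 1]) auto
    qed
    also have "\<dots> = (\<Prod>i\<in>J. LINT \<omega>|M. exp (- (c i u * \<zeta> i \<omega>)))"
    proof (intro prod.cong refl integral_cong_AE)
      fix i assume i: "i \<in> J"
      from AE_nn show "AE \<omega> in M. exp (- (c i u * max 0 (\<zeta> i \<omega>))) = exp (- (c i u * \<zeta> i \<omega>))"
        by eventually_elim (use i in \<open>simp add: max_absorb2\<close>)
    qed measurable
    also have "\<dots> = (\<Prod>i\<in>J. 1 / (1 + c i u))"
      using c_nn by (intro prod.cong exponential_distributed_laplace D) auto
    finally show ?thesis .
  qed
  have "(LINT \<omega>|M. exp (- (\<Sum>i\<in>J. c i (U \<omega>) * \<zeta> i \<omega>))) = (LINT \<omega>|M. F (U \<omega>) (V \<omega>))"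
  proof (rule integral_cong_AE)
    show "AE \<omega> in M. exp (- (\<Sum>i\<in>J. c i (U \<omega>) * \<zeta> i \<omega>)) = F (U \<omega>) (V \<omega>)"
      using AE_nn by eventually_elim (simp add: F_def VJ max_absorb2 cong: sum.cong)
    have [measurable]: "(\<lambda>\<omega>. c i (U \<omega>)) \<in> borel_measurable M" if "i \<in> J" for i
      using measurable_compose[OF U c[OF that]] .
    show "(\<lambda>\<omega>. exp (- (\<Sum>i\<in>J. c i (U \<omega>) * \<zeta> i \<omega>))) \<in> borel_measurable M"
      by measurable
    show "(\<lambda>\<omega>. F (U \<omega>) (V \<omega>)) \<in> borel_measurable M"
      using measurable_compose[OF measurable_Pair[OF U V] Fm] by simp
  qed
  also have "\<dots> = (LINT p|distr M (S \<Otimes>\<^sub>M PiM L (\<lambda>_. borel)) (\<lambda>\<omega>. (U \<omega>, V \<omega>)). (\<lambda>(u, v). F u v) p)"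
    by (subst integral_distr[OF _ Fm]) auto
  also have "\<dots> = (LINT u|distr M S U. LINT v|distr M (PiM L (\<lambda>_. borel)) V. F u v)"
    unfolding joint[symmetric]
  proof (rule PP.integral_fst[symmetric])
    show "integrable (distr M S U \<Otimes>\<^sub>M distr M (PiM L (\<lambda>_. borel)) V) (\<lambda>(u, v). F u v)"
      using F_bound Fm by (intro PP.P.integrable_const_bound[where B = 1]) auto
  qed
  also have "\<dots> = (LINT u|distr M S U. LINT \<omega>|M. F u (V \<omega>))"
  proof (rule Bochner_Integration.integral_cong[OF refl])
    fix u assume "u \<in> space (distr M S U)"
    then have "F u \<in> borel_measurable (PiM L (\<lambda>_. borel))"
      using measurable_Pair2[OF Fm, of u] by simp
    then show "(LINT v|distr M (PiM L (\<lambda>_. borel)) V. F u v) = (LINT \<omega>|M. F u (V \<omega>))"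
      by (rule integral_distr[OF V])
  qed
  also have "\<dots> = (LINT \<omega>|M. (\<Prod>i\<in>J. 1 / (1 + c i (U \<omega>))))"
    unfolding Fu by (rule integral_distr[OF U]) measurable
  finally show ?thesis .
qed

text \<open>Which indices carry a nonzero weight is random, so the series is cut at a deterministic
  index \<open>j\<close>, where the result for finitely many marks applies. Almost surely the series
  have finitely many nonzero terms, and all exponentials are bounded by 1, so \<open>j\<close> can
  tend to infinity. The logarithms turn the product back into a sum over indices.\<close>

lemma laplace_marked_series:
  fixes \<zeta> :: "'i \<Rightarrow> nat \<Rightarrow> 'a \<Rightarrow> real" and c :: "'i \<Rightarrow> nat \<Rightarrow> 'u \<Rightarrow> real"
  assumes I: "finite I"
    and U[measurable]: "U \<in> measurable M S"
    and UV: "indep_set (sets (vimage_algebra (space M) U S))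
       (sets (vimage_algebra (space M) (\<lambda>\<omega>. \<lambda>(n, k)\<in>I \<times> UNIV. \<zeta> n k \<omega>) (PiM (I \<times> UNIV) (\<lambda>_. borel))))"
    and c: "\<And>n k. n \<in> I \<Longrightarrow> c n k \<in> borel_measurable S" and c_nn: "\<And>n k u. 0 \<le> c n k u"
    and c_fin: "AE \<omega> in M. \<forall>n\<in>I. finite {k. c n k (U \<omega>) \<noteq> 0}"
    and D: "\<And>n k. n \<in> I \<Longrightarrow> distributed M lborel (\<zeta> n k) (exponential_density 1)"
    and indep: "indep_vars (\<lambda>_. borel) (\<lambda>(n, k). \<zeta> n k) (I \<times> UNIV)"
  shows "(LINT \<omega>|M. exp (- (\<Sum>n\<in>I. \<Sum>k. c n k (U \<omega>) * \<zeta> n k \<omega>)))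
       = (LINT \<omega>|M. exp (- (\<Sum>n\<in>I. \<Sum>k. ln (1 + c n k (U \<omega>)))))"
proof -
  have [measurable]: "\<zeta> n k \<in> borel_measurable M" if "n \<in> I" for n k
    using distributed_measurable[OF D[OF that]] by simp
  have [measurable]: "(\<lambda>\<omega>. c n k (U \<omega>)) \<in> borel_measurable M" if "n \<in> I" for n k
    using measurable_compose[OF U c[OF that]] .
  have AE_nn: "AE \<omega> in M. \<forall>n\<in>I. \<forall>k. 0 \<le> \<zeta> n k \<omega>"
    using D by (intro AE_finite_allI I AE_all_countable[THEN iffD2] allI exponential_distributed_AE_nonneg)
  have partial: "(LINT \<omega>|M. exp (- (\<Sum>n\<in>I. \<Sum>k<j. c n k (U \<omega>) * \<zeta> n k \<omega>)))
      = (LINT \<omega>|M. exp (- (\<Sum>n\<in>I. \<Sum>k<j. ln (1 + c n k (U \<omega>)))))" for j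
  proof -
    have "(LINT \<omega>|M. exp (- (\<Sum>n\<in>I. \<Sum>k<j. c n k (U \<omega>) * \<zeta> n k \<omega>)))
        = (LINT \<omega>|M. exp (- (\<Sum>i\<in>I \<times> {..<j}. case_prod c i (U \<omega>) * case_prod \<zeta> i \<omega>)))"
      by (simp add: sum.cartesian_product case_prod_beta')
    also have "\<dots> = (LINT \<omega>|M. (\<Prod>i\<in>I \<times> {..<j}. 1 / (1 + case_prod c i (U \<omega>))))"
    proof (rule laplace_exponential_marks[OF _ _ U, where L = "I \<times> UNIV"])
      have "(\<lambda>\<omega>. \<lambda>(n, k)\<in>I \<times> UNIV. \<zeta> n k \<omega>) = (\<lambda>\<omega>. \<lambda>i\<in>I \<times> UNIV. case_prod \<zeta> i \<omega>)"
        by (auto simp: fun_eq_iff restrict_def)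
      then show "indep_set (sets (vimage_algebra (space M) U S))
         (sets (vimage_algebra (space M) (\<lambda>\<omega>. \<lambda>i\<in>I \<times> UNIV. case_prod \<zeta> i \<omega>) (PiM (I \<times> UNIV) (\<lambda>_. borel))))"
        using UV by simp
    qed (use I c c_nn D indep in \<open>auto split: prod.splits\<close>)
    also have "\<dots> = (LINT \<omega>|M. exp (- (\<Sum>n\<in>I. \<Sum>k<j. ln (1 + c n k (U \<omega>)))))"
    proof (rule Bochner_Integration.integral_cong[OF refl])
      fix \<omega>
      have "exp (- ln (1 + c n k (U \<omega>))) = 1 / (1 + c n k (U \<omega>))" for n k
        using c_nn[of n k "U \<omega>"] by (simp add: exp_minus add_pos_nonneg inverse_eq_divide)
      then show "(\<Prod>i\<in>I \<times> {..<j}. 1 / (1 + case_prod c i (U \<omega>)))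
          = exp (- (\<Sum>n\<in>I. \<Sum>k<j. ln (1 + c n k (U \<omega>))))"
        using I by (simp add: sum.cartesian_product exp_sum case_prod_beta' flip: sum_negf)
    qed
    finally show ?thesis .
  qed
  have "(\<lambda>j. LINT \<omega>|M. exp (- (\<Sum>n\<in>I. \<Sum>k<j. c n k (U \<omega>) * \<zeta> n k \<omega>)))
      \<longlonglongrightarrow> (LINT \<omega>|M. exp (- (\<Sum>n\<in>I. \<Sum>k. c n k (U \<omega>) * \<zeta> n k \<omega>)))"
  proof (rule integral_dominated_convergence[where w = "\<lambda>_. 1"])
    show "AE \<omega> in M. (\<lambda>j. exp (- (\<Sum>n\<in>I. \<Sum>k<j. c n k (U \<omega>) * \<zeta> n k \<omega>)))
        \<longlonglongrightarrow> exp (- (\<Sum>n\<in>I. \<Sum>k. c n k (U \<omega>) * \<zeta> n k \<omega>))"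
      using c_fin
    proof eventually_elim
      case (elim \<omega>)
      have "summable (\<lambda>k. c n k (U \<omega>) * \<zeta> n k \<omega>)" if "n \<in> I" for n
        using elim that by (intro summable_finite[of "{k. c n k (U \<omega>) \<noteq> 0}"]) auto
      then show ?case by (intro tendsto_intros summable_LIMSEQ)
    qed
    show "AE \<omega> in M. norm (exp (- (\<Sum>n\<in>I. \<Sum>k<j. c n k (U \<omega>) * \<zeta> n k \<omega>))) \<le> 1" for j
      using AE_nn by eventually_elim (auto intro!: sum_nonneg mult_nonneg_nonneg c_nn)
  qed measurable
  moreover have "(\<lambda>j. LINT \<omega>|M. exp (- (\<Sum>n\<in>I. \<Sum>k<j. ln (1 + c n k (U \<omega>)))))
      \<longlonglongrightarrow> (LINT \<omega>|M. exp (- (\<Sum>n\<in>I. \<Sum>k. ln (1 + c n k (U \<omega>)))))"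
  proof (rule integral_dominated_convergence[where w = "\<lambda>_. 1"])
    show "AE \<omega> in M. (\<lambda>j. exp (- (\<Sum>n\<in>I. \<Sum>k<j. ln (1 + c n k (U \<omega>)))))
        \<longlonglongrightarrow> exp (- (\<Sum>n\<in>I. \<Sum>k. ln (1 + c n k (U \<omega>))))"
      using c_fin
    proof eventually_elim
      case (elim \<omega>)
      have "summable (\<lambda>k. ln (1 + c n k (U \<omega>)))" if "n \<in> I" for n
        using elim that by (intro summable_finite[of "{k. c n k (U \<omega>) \<noteq> 0}"]) auto
      then show ?case by (intro tendsto_intros summable_LIMSEQ)
    qed
    show "AE \<omega> in M. norm (exp (- (\<Sum>n\<in>I. \<Sum>k<j. ln (1 + c n k (U \<omega>))))) \<le> 1" for j
      using c_nn by (auto intro!: sum_nonneg)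
  qed measurable
  ultimately show ?thesis unfolding partial by (rule LIMSEQ_unique)
qed

end

section \<open>Polar coordinates in the plane\<close>

lemma measurable_vector_pair:
  "(\<lambda>(x, y). vector [x, y] :: real ^ 2) \<in> borel_measurable (lborel \<Otimes>\<^sub>M lborel)"
proof -
  have "(\<lambda>(x, y). vector [x, y] :: real ^ 2) = (\<lambda>p. fst p *\<^sub>R axis 1 1 + snd p *\<^sub>R axis 2 1)"
    by (auto simp: fun_eq_iff vec_eq_iff forall_2 axis_def)
  then show ?thesis by simp
qed

text \<open>Lebesgue measure is determined by its values on boxes. This identification makes Fubini
  in radius and angle available on \<open>real ^ 2\<close>, the space on which the change of
  variables takes place.\<close>

lemma lborel_real2_eq_distr:
  "(lborel :: (real ^ 2) measure) = distr (lborel \<Otimes>\<^sub>M lborel) borel (\<lambda>(x, y). vector [x, y])"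
proof (rule lborel_eqI)
  fix l u :: "real ^ 2" assume le: "\<And>b. b \<in> Basis \<Longrightarrow> l \<bullet> b \<le> u \<bullet> b"
  have le': "l $ i \<le> u $ i" for i
    using le[of "axis i 1"] by (simp add: inner_axis axis_in_Basis_iff)
  have pre: "(\<lambda>(x, y). vector [x, y]) -` box l u \<inter> space (lborel \<Otimes>\<^sub>M lborel)
      = {l $ 1<..<u $ 1} \<times> {l $ 2<..<u $ 2}"
    by (auto simp: mem_box_cart forall_2 space_pair_measure)
  have "emeasure (distr (lborel \<Otimes>\<^sub>M lborel) borel (\<lambda>(x, y). vector [x, y])) (box l u)
      = emeasure (lborel \<Otimes>\<^sub>M lborel) ({l $ 1<..<u $ 1} \<times> {l $ 2<..<u $ 2})"
    by (subst emeasure_distr[OF measurable_vector_pair]) (auto simp: pre)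
  also have "\<dots> = ennreal (u $ 1 - l $ 1) * ennreal (u $ 2 - l $ 2)"
    using le' by (subst lborel.emeasure_pair_measure_Times) auto
  also have "\<dots> = ennreal (\<Prod>b\<in>Basis. (u - l) \<bullet> b)"
  proof -
    have "(Basis :: (real ^ 2) set) = {axis 1 1, axis 2 1}"
      by (auto simp: Basis_vec_def UNIV_2)
    then have "(\<Prod>b\<in>Basis. (u - l) \<bullet> b) = (\<Prod>b\<in>{axis 1 1, axis 2 1}. (u - l) \<bullet> b)"
      by (rule arg_cong)
    also have "\<dots> = ((u - l) \<bullet> axis 1 1) * ((u - l) \<bullet> axis 2 1)"
      by (simp add: axis_eq_axis)
    finally show ?thesis using le'[of 1] le'[of 2] by (simp add: inner_axis flip: ennreal_mult)
  qed
  finally show "emeasure (distr (lborel \<Otimes>\<^sub>M lborel) borel (\<lambda>(x, y). vector [x, y])) (box l u)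
      = ennreal (\<Prod>b\<in>Basis. (u - l) \<bullet> b)" .
qed simp

text \<open>The integrand is passed to the vector-valued change-of-variables theorem as a map into
  \<open>real ^ 1\<close>.\<close>

lemma integral_change_of_variables_real_valued:
  fixes f :: "real ^ 'm::{finite,wellorder} \<Rightarrow> real" and g :: "real ^ 'm::_ \<Rightarrow> real ^ 'm::_"
  assumes S: "S \<in> sets lebesgue"
    and der: "\<And>x. x \<in> S \<Longrightarrow> (g has_derivative g' x) (at x within S)"
    and inj: "inj_on g S"
    and f: "f absolutely_integrable_on (g ` S)"
  shows "integral (g ` S) f = integral S (\<lambda>x. \<bar>det (matrix (g' x))\<bar> * f (g x))"
proof -
  have "(\<lambda>x. \<bar>det (matrix (g' x))\<bar> *\<^sub>R vec (f (g x)) :: real ^ 1) absolutely_integrable_on S \<and>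
        integral S (\<lambda>x. \<bar>det (matrix (g' x))\<bar> *\<^sub>R vec (f (g x))) = (vec b :: real ^ 1)
    \<longleftrightarrow> (\<lambda>x. vec (f x) :: real ^ 1) absolutely_integrable_on (g ` S) \<and>
        integral (g ` S) (\<lambda>x. vec (f x)) = (vec b :: real ^ 1)" for b
    by (rule has_absolute_integral_change_of_variables[OF S der inj])
  then have "(\<lambda>x. \<bar>det (matrix (g' x))\<bar> * f (g x)) absolutely_integrable_on S \<and>
        integral S (\<lambda>x. \<bar>det (matrix (g' x))\<bar> * f (g x)) = integral (g ` S) f"
    using f by (simp add: absolutely_integrable_on_1_iff integral_on_1_eq)
  then show ?thesis by simp
qed

lemma set_integrable_bounded_set:
  fixes f :: "'a::euclidean_space \<Rightarrow> real"
  assumes [measurable]: "A \<in> sets borel" "f \<in> borel_measurable borel" and A: "bounded A"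
    and f: "\<And>x. x \<in> A \<Longrightarrow> \<bar>f x\<bar> \<le> B"
  shows "set_integrable lborel A f"
  unfolding set_integrable_def
  using f emeasure_bounded_finite[OF A]
  by (intro integrableI_bounded_set_indicator[where B = B]) auto

text \<open>A positive radius and a half-open range of angles make the polar map injective, at the
  price of the centre, which is a null set. Positivity is a separate condition because
  \<open>a\<close> may be 0. The offset \<alpha> leaves the direction of angle zero free.\<close>

lemma annulus_eq_polar_image:
  fixes c :: "real ^ 2" and \<alpha> a b :: real
  assumes a: "0 \<le> a"
  defines "p \<equiv> \<lambda>v :: real ^ 2. c + (v $ 1 * cos (v $ 2 + \<alpha>)) *\<^sub>R axis 1 1 + (v $ 1 * sin (v $ 2 + \<alpha>)) *\<^sub>R axis 2 1"
  shows "p ` {v. a \<le> v $ 1 \<and> 0 < v $ 1 \<and> v $ 1 \<le> b \<and> 0 \<le> v $ 2 \<and> v $ 2 < 2 * pi}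
      = {w. a \<le> dist w c \<and> dist w c \<le> b} - {c}" (is "p ` ?S = ?A")
    and "inj_on p {v. a \<le> v $ 1 \<and> 0 < v $ 1 \<and> v $ 1 \<le> b \<and> 0 \<le> v $ 2 \<and> v $ 2 < 2 * pi}"
proof -
  have comp: "(p v - c) $ 1 = v $ 1 * cos (v $ 2 + \<alpha>)" "(p v - c) $ 2 = v $ 1 * sin (v $ 2 + \<alpha>)" for v
    by (simp_all add: p_def axis_def)
  have norm2: "norm w = sqrt ((w $ 1)\<^sup>2 + (w $ 2)\<^sup>2)" for w :: "real ^ 2"
    by (simp add: norm_vec_def L2_set_def sum_2)
  have dist: "dist (p v) c = v $ 1" if "0 < v $ 1" for v
  proof -
    have "(v $ 1 * cos (v $ 2 + \<alpha>))\<^sup>2 + (v $ 1 * sin (v $ 2 + \<alpha>))\<^sup>2 = (v $ 1)\<^sup>2"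
      by (simp add: power_mult_distrib flip: distrib_left)
    then show ?thesis
      unfolding dist_norm norm2 comp using that by simp
  qed
  have "w \<in> p ` ?S" if w: "w \<in> ?A" for w
  proof -
    define r where "r = dist w c"
    have r: "0 < r" "a \<le> r" "r \<le> b" using w by (auto simp: r_def)
    \<comment> \<open>\<open>(x, y)\<close> is the unit vector of \<open>w - c\<close> turned back
      by \<alpha>, so its angle \<open>t\<close> is the polar angle of \<open>w\<close> in the
      turned frame.\<close>
    define x where "x = ((w - c) $ 1 * cos \<alpha> + (w - c) $ 2 * sin \<alpha>) / r"
    define y where "y = ((w - c) $ 2 * cos \<alpha> - (w - c) $ 1 * sin \<alpha>) / r"
    have sc: "sin \<alpha> * sin \<alpha> = 1 - cos \<alpha> * cos \<alpha>"
      using sin_squared_eq[of \<alpha>] by (simp add: power2_eq_square)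
    have r2: "((w - c) $ 1)\<^sup>2 + ((w - c) $ 2)\<^sup>2 = r\<^sup>2"
      unfolding r_def dist_norm norm2 by simp
    have rx: "r * x = (w - c) $ 1 * cos \<alpha> + (w - c) $ 2 * sin \<alpha>"
      and ry: "r * y = (w - c) $ 2 * cos \<alpha> - (w - c) $ 1 * sin \<alpha>"
      using r by (auto simp: x_def y_def)
    have "(r * x)\<^sup>2 + (r * y)\<^sup>2 = (((w - c) $ 1)\<^sup>2 + ((w - c) $ 2)\<^sup>2) * ((sin \<alpha>)\<^sup>2 + (cos \<alpha>)\<^sup>2)"
      unfolding rx ry by algebra
    then have "r\<^sup>2 * (x\<^sup>2 + y\<^sup>2) = r\<^sup>2"
      unfolding r2 by (simp add: power_mult_distrib distrib_left)
    then have "x\<^sup>2 + y\<^sup>2 = 1" using r by simp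
    then obtain t where t: "0 \<le> t" "t < 2 * pi" "x = cos t" "y = sin t"
      by (rule sincos_total_2pi)
    note X = rx[unfolded t] and Y = ry[unfolded t]
    have "r * cos (t + \<alpha>) = (r * cos t) * cos \<alpha> - (r * sin t) * sin \<alpha>"
      by (simp add: cos_add algebra_simps)
    also have "\<dots> = (w - c) $ 1 * (cos \<alpha> * cos \<alpha> + sin \<alpha> * sin \<alpha>)"
      unfolding X Y by algebra
    finally have 1: "r * cos (t + \<alpha>) = (w - c) $ 1" by (simp only: sc) simp
    have "r * sin (t + \<alpha>) = (r * sin t) * cos \<alpha> + (r * cos t) * sin \<alpha>"
      by (simp add: sin_add algebra_simps)
    also have "\<dots> = (w - c) $ 2 * (cos \<alpha> * cos \<alpha> + sin \<alpha> * sin \<alpha>)"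
      unfolding X Y by algebra
    finally have 2: "r * sin (t + \<alpha>) = (w - c) $ 2" by (simp only: sc) simp
    have "p (vector [r, t]) = w"
      using 1 2 by (simp add: p_def vec_eq_iff forall_2 axis_def)
    then show ?thesis
      using r t by (intro image_eqI[where x = "vector [r, t]"]) auto
  qed
  moreover have "p v \<in> ?A" if "v \<in> ?S" for v
    using that dist[of v] by auto
  ultimately show "p ` ?S = ?A" by blast
  show "inj_on p ?S"
  proof (rule inj_onI)
    fix v w assume v: "v \<in> ?S" and w: "w \<in> ?S" and eq: "p v = p w"
    have r: "v $ 1 = w $ 1" using dist[of v] dist[of w] v w eq by simp
    have "cos (v $ 2 + \<alpha>) = cos (w $ 2 + \<alpha>)" "sin (v $ 2 + \<alpha>) = sin (w $ 2 + \<alpha>)"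
      using comp[of v] comp[of w] v r unfolding eq by auto
    then obtain k :: int where k: "v $ 2 + \<alpha> = w $ 2 + \<alpha> + 2 * pi * k"
      using sin_cos_eq_iff by blast
    \<comment> \<open>Both angles lie in [0, 2 pi), so they differ by less than a full turn and
      \<open>k\<close> must be 0.\<close>
    have "2 * pi * k = v $ 2 - w $ 2" using k by simp
    then have "\<bar>2 * pi * k\<bar> < 2 * pi" using v w by auto
    then have "2 * pi * \<bar>real_of_int k\<bar> < 2 * pi * 1" by (simp add: abs_mult)
    then have "\<bar>real_of_int k\<bar> < 1" by (rule mult_left_less_imp_less) simp
    then have "k = 0" by linarith
    then show "v = w" using k r by (simp add: vec_eq_iff forall_2)
  qed
qed

text \<open>Boundedness of \<open>g\<close> on a bounded annulus makes all integrals absolute. The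
  Lebesgue integral can then be read as a gauge integral for the change of variables, and read back
  as an integral over a product for Fubini.\<close>

lemma integral_annulus_polar:
  fixes g :: "real ^ 2 \<Rightarrow> real" and c :: "real ^ 2"
  assumes g[measurable]: "g \<in> borel_measurable borel" and B: "\<And>w. \<bar>g w\<bar> \<le> B" and a: "0 \<le> a"
  shows "(LINT w|lborel. indicator {w. a \<le> dist w c \<and> dist w c \<le> b} w * g w)
       = (LBINT \<psi>:{0..2 * pi}. LBINT r:{a..b}.
            g (c + (r * cos (\<psi> + \<alpha>)) *\<^sub>R axis 1 1 + (r * sin (\<psi> + \<alpha>)) *\<^sub>R axis 2 1) * r)"
proof -
  define p where "p v = c + (v $ 1 * cos (v $ 2 + \<alpha>)) *\<^sub>R axis 1 1 + (v $ 1 * sin (v $ 2 + \<alpha>)) *\<^sub>R axis 2 1"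
    for v :: "real ^ 2"
  define p' where "p' v h = ((h $ 1 * cos (v $ 2 + \<alpha>) - v $ 1 * (sin (v $ 2 + \<alpha>) * h $ 2)) *\<^sub>R axis 1 1
      + (h $ 1 * sin (v $ 2 + \<alpha>) + v $ 1 * (cos (v $ 2 + \<alpha>) * h $ 2)) *\<^sub>R axis 2 1 :: real ^ 2)"
    for v h :: "real ^ 2"
  define S where "S = {v :: real ^ 2. a \<le> v $ 1 \<and> 0 < v $ 1 \<and> v $ 1 \<le> b \<and> 0 \<le> v $ 2 \<and> v $ 2 < 2 * pi}"
  define A where "A = {w. a \<le> dist w c \<and> dist w c \<le> b}"
  have [measurable]: "(\<lambda>v::real ^ 2. v $ i) \<in> borel_measurable borel" for i
    by (intro borel_measurable_continuous_onI continuous_intros)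
  have Sb[measurable]: "S \<in> sets borel" unfolding S_def by measurable
  have Ab[measurable]: "A \<in> sets borel" unfolding A_def by measurable
  have pm[measurable]: "p \<in> borel_measurable borel" unfolding p_def by measurable
  have image: "p ` S = A - {c}" and inj: "inj_on p S"
    unfolding p_def S_def A_def by (rule annulus_eq_polar_image[OF a])+
  have der: "(p has_derivative p' v) (at v within S)" for v
    unfolding p_def p'_def
    by (auto intro!: derivative_eq_intros bounded_linear_imp_has_derivative bounded_linear_vec_nth
        simp: algebra_simps)
  have det: "det (matrix (p' v)) = v $ 1" for v
  proof -
    have "det (matrix (p' v)) = v $ 1 * ((sin (v $ 2 + \<alpha>))\<^sup>2 + (cos (v $ 2 + \<alpha>))\<^sup>2)"
      unfolding det_2
      by (simp add: matrix_def p'_def axis_def distrib_left power2_eq_square mult.assoc mult.left_commute)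
    then show ?thesis by simp
  qed
  have "bounded A"
    by (rule bounded_subset[OF bounded_cball[of c b]]) (auto simp: A_def dist_commute)
  then have bA: "bounded (A - {c})" by (rule bounded_subset) auto
  have gA: "set_integrable lborel (A - {c}) g"
    by (intro set_integrable_bounded_set[OF _ _ bA B]) auto
  have "S \<subseteq> cbox (vector [0, 0]) (vector [b, 2 * pi])"
    by (auto simp: S_def mem_box_cart forall_2)
  then have bS: "bounded S" using bounded_cbox bounded_subset by blast
  have gS: "set_integrable lborel S (\<lambda>v. v $ 1 * g (p v))"
  proof (rule set_integrable_bounded_set[OF Sb _ bS, where B = "b * B"])
    show "\<bar>v $ 1 * g (p v)\<bar> \<le> b * B" if "v \<in> S" for v
      unfolding abs_mult using that B by (intro mult_mono) (auto simp: S_def)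
  qed measurable
  have "(LINT w|lborel. indicator A w * g w) = (LBINT w:A - {c}. g w)"
    unfolding set_lebesgue_integral_def
  proof (rule integral_cong_AE)
    have "AE w in lborel. w \<noteq> c" by (rule AE_lborel_singleton)
    then show "AE w in lborel. indicator A w * g w = indicator (A - {c}) w *\<^sub>R g w"
      by eventually_elim (auto simp: indicator_def)
  qed measurable
  also have "\<dots> = integral (p ` S) g"
    unfolding image by (rule set_borel_integral_eq_integral(2)[OF gA])
  also have "\<dots> = integral S (\<lambda>v. \<bar>det (matrix (p' v))\<bar> * g (p v))"
  proof (rule integral_change_of_variables_real_valued[OF _ der inj])
    show "g absolutely_integrable_on p ` S"
      unfolding image using gA by (simp add: set_integrable_def integrable_completion)
  qed simp
  also have "\<dots> = integral S (\<lambda>v. v $ 1 * g (p v))"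
    unfolding det by (intro integral_cong) (auto simp: S_def)
  also have "\<dots> = (LBINT v:S. v $ 1 * g (p v))"
    by (rule set_borel_integral_eq_integral(2)[OF gS, symmetric])
  also have "\<dots> = (LINT v|lborel. indicator S v * (v $ 1 * g (p v)))"
    by (simp add: set_lebesgue_integral_def)
  finally have 1: "(LINT w|lborel. indicator A w * g w) = (LINT v|lborel. indicator S v * (v $ 1 * g (p v)))" .
  define h where "h v = indicator S v * (v $ 1 * g (p v))" for v
  have [measurable]: "h \<in> borel_measurable borel" unfolding h_def by measurable
  have hint: "integrable lborel h"
    using gS by (simp add: set_integrable_def h_def[abs_def])
  then have "integrable (distr (lborel \<Otimes>\<^sub>M lborel) borel (\<lambda>(x, y). vector [x, y])) h"
    by (subst (asm) lborel_real2_eq_distr)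
  then have hint': "integrable (lborel \<Otimes>\<^sub>M lborel) (\<lambda>(x, y). h (vector [x, y]))"
    by (subst (asm) integrable_distr_eq[OF measurable_vector_pair]) (auto simp: case_prod_beta')
  \<comment> \<open>The condition of positive radius in \<open>S\<close> disappears here: at radius
    0 the Jacobian factor \<open>x\<close> vanishes.\<close>
  have hxy: "h (vector [x, y]) = indicator {0..<2 * pi} y * (indicator {a..b} x *
      (g (c + (x * cos (y + \<alpha>)) *\<^sub>R axis 1 1 + (x * sin (y + \<alpha>)) *\<^sub>R axis 2 1) * x))" for x y
    using a by (auto simp: h_def S_def p_def indicator_def)
  have "(LINT v|lborel. h v) = (LINT v|distr (lborel \<Otimes>\<^sub>M lborel) borel (\<lambda>(x, y). vector [x, y]). h v)"
    by (subst lborel_real2_eq_distr) simp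
  also have "\<dots> = (LINT q|(lborel \<Otimes>\<^sub>M lborel). (\<lambda>(x, y). h (vector [x, y])) q)"
    by (subst integral_distr[OF measurable_vector_pair]) (auto simp: case_prod_beta')
  also have "\<dots> = (LINT y|lborel. LINT x|lborel. h (vector [x, y]))"
    by (rule lborel_pair.integral_snd[of "\<lambda>x y. h (vector [x, y])", OF hint', symmetric])
  also have "\<dots> = (LINT y|lborel. indicator {0..<2 * pi} y * (LINT x|lborel. indicator {a..b} x *
      (g (c + (x * cos (y + \<alpha>)) *\<^sub>R axis 1 1 + (x * sin (y + \<alpha>)) *\<^sub>R axis 2 1) * x)))"
    unfolding hxy by simp
  also have "\<dots> = (LINT y|lborel. indicator {0..2 * pi} y * (LINT x|lborel. indicator {a..b} x *
      (g (c + (x * cos (y + \<alpha>)) *\<^sub>R axis 1 1 + (x * sin (y + \<alpha>)) *\<^sub>R axis 2 1) * x)))"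
  proof (rule integral_cong_AE)
    have "AE y in lborel. y \<noteq> 2 * pi" by (rule AE_lborel_singleton)
    then show "AE y in lborel. indicator {0..<2 * pi} y * (LINT x|lborel. indicator {a..b} x *
        (g (c + (x * cos (y + \<alpha>)) *\<^sub>R axis 1 1 + (x * sin (y + \<alpha>)) *\<^sub>R axis 2 1) * x))
      = indicator {0..2 * pi} y * (LINT x|lborel. indicator {a..b} x *
        (g (c + (x * cos (y + \<alpha>)) *\<^sub>R axis 1 1 + (x * sin (y + \<alpha>)) *\<^sub>R axis 2 1) * x))"
      by eventually_elim (auto simp: indicator_def)
  qed measurable
  finally show ?thesis
    unfolding 1[unfolded A_def] h_def set_lebesgue_integral_def real_scaleR_def .
qed

section \<open>Packet overlap\<close>

definition overlap :: "real \<Rightarrow> real \<Rightarrow> real" where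
  "overlap T t = max 0 (1 - \<bar>t\<bar> / T)"

lemma overlap_measurable[measurable]: "overlap T \<in> borel_measurable borel"
  unfolding overlap_def by measurable

lemma overlap_nonneg: "0 \<le> overlap T t" by (simp add: overlap_def)

lemma overlap_eq_0: "0 < T \<Longrightarrow> T < \<bar>t\<bar> \<Longrightarrow> overlap T t = 0"
  by (simp add: overlap_def max_def field_simps)

lemma measure_overlap:
  fixes T u :: real
  assumes T: "0 < T"
  shows "measure lborel ({0..T} \<inter> {u..<u + T}) = T * overlap T u"
proof -
  have "{0..T} \<inter> {u..<u + T} = (if 0 < u then {u..T} else {0..<u + T})"
    using T by auto
  then show ?thesis
    using T by (auto simp: overlap_def max_def field_simps)
qed

text \<open>A statement about one outcome. A packet started at distance more than \<open>T\<close>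
  from 0 misses the reference interval, so outside the finite sets \<open>K n\<close> nothing
  contributes, and exchanging series and integral is linearity for finite sums.\<close>

lemma packet_time_average:
  fixes T :: real
  assumes T: "0 < T" and I: "finite I"
    and K: "\<And>n. n \<in> I \<Longrightarrow> finite (K n)"
    and out: "\<And>n k. n \<in> I \<Longrightarrow> k \<notin> K n \<Longrightarrow> a n k = 0 \<or> T < \<bar>u n k\<bar>"
  shows "1 / T * (LBINT t:{0..T}. \<Sum>n\<in>I. \<Sum>k. if u n k \<le> t \<and> t < u n k + T then a n k else 0)
       = (\<Sum>n\<in>I. \<Sum>k. a n k * overlap T (u n k))" (is "1 / T * ?L = ?R")
proof -
  have "?L = (LINT t|lborel. (\<Sum>n\<in>I. \<Sum>k\<in>K n. a n k * indicator ({0..T} \<inter> {u n k..<u n k + T}) t))"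
    unfolding set_lebesgue_integral_def
  proof (rule Bochner_Integration.integral_cong[OF refl])
    fix t :: real
    show "indicator {0..T} t *\<^sub>R (\<Sum>n\<in>I. \<Sum>k. if u n k \<le> t \<and> t < u n k + T then a n k else 0)
        = (\<Sum>n\<in>I. \<Sum>k\<in>K n. a n k * indicator ({0..T} \<inter> {u n k..<u n k + T}) t)"
    proof (cases "t \<in> {0..T}")
      case True
      have "(\<Sum>k. if u n k \<le> t \<and> t < u n k + T then a n k else 0)
          = (\<Sum>k\<in>K n. a n k * indicator ({0..T} \<inter> {u n k..<u n k + T}) t)" if n: "n \<in> I" for n
      proof -
        have "(\<Sum>k. if u n k \<le> t \<and> t < u n k + T then a n k else 0)
            = (\<Sum>k\<in>K n. if u n k \<le> t \<and> t < u n k + T then a n k else 0)"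
          using out[OF n] True by (intro suminf_finite K[OF n]) force
        also have "\<dots> = (\<Sum>k\<in>K n. a n k * indicator ({0..T} \<inter> {u n k..<u n k + T}) t)"
          using True by (intro sum.cong) auto
        finally show ?thesis .
      qed
      then show ?thesis using True by simp
    qed (simp add: indicator_inter_arith)
  qed
  also have "\<dots> = (\<Sum>n\<in>I. \<Sum>k\<in>K n. a n k * (T * overlap T (u n k)))"
  proof -
    have fin: "emeasure lborel ({0..T} \<inter> {u n k..<u n k + T}) < \<infinity>" for n k
      by (rule emeasure_bounded_finite) (simp add: bounded_Int)
    then have "integrable lborel (\<lambda>t. a n k * indicator ({0..T} \<inter> {u n k..<u n k + T}) t)" for n k
      by (intro integrable_mult_right integrable_real_indicator) auto
    then show ?thesis
      by (simp add: Bochner_Integration.integral_sum measure_overlap[OF T])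
  qed
  also have "\<dots> = T * (\<Sum>n\<in>I. \<Sum>k\<in>K n. a n k * overlap T (u n k))"
    by (simp add: sum_distrib_left mult_ac)
  also have "(\<Sum>n\<in>I. \<Sum>k\<in>K n. a n k * overlap T (u n k)) = ?R"
  proof (rule sum.cong[OF refl])
    fix n assume n: "n \<in> I"
    show "(\<Sum>k\<in>K n. a n k * overlap T (u n k)) = (\<Sum>k. a n k * overlap T (u n k))"
      using out[OF n] overlap_eq_0[OF T] by (intro suminf_finite[symmetric] K[OF n]) force
  qed
  finally show ?thesis using T by simp
qed

text \<open>The kernel vanishes off [-T, T], and on each half it has an elementary antiderivative.
  Each half contributes T - (T / x) * ln(1 + x).\<close>

lemma triangle_kernel_integral:
  fixes T x :: real
  assumes T: "0 < T" and x: "0 < x"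
  shows "(LINT t|lborel. 1 - 1 / (1 + x * max 0 (1 - \<bar>t\<bar> / T))) = 2 * T * (1 + 1 / x * ln (1 / (1 + x)))"
proof -
  define g1 where "g1 t = 1 - 1 / (1 + x * (1 + t / T))" for t
  define g2 where "g2 t = 1 - 1 / (1 + x * (1 - t / T))" for t
  define F1 where "F1 t = t - T / x * ln (1 + x * (1 + t / T))" for t
  define F2 where "F2 t = t + T / x * ln (1 + x * (1 - t / T))" for t
  have pos1: "0 < 1 + x * (1 + t / T)" if "- T \<le> t" for t
  proof -
    have "0 \<le> x * (1 + t / T)" using that T x by (intro mult_nonneg_nonneg) (auto simp: field_simps)
    then show ?thesis by simp
  qed
  have pos2: "0 < 1 + x * (1 - t / T)" if "t \<le> T" for t
    using pos1[of "- t"] that by simp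
  have c1: "continuous_on {- T..0} g1" unfolding g1_def
    using pos1 T by (intro continuous_intros) (force simp: less_le)+
  have c2: "continuous_on {0..T} g2" unfolding g2_def
    using pos2 T by (intro continuous_intros) (force simp: less_le)+
  have 1: "(LINT t|lborel. indicator {- T..0} t *\<^sub>R g1 t) = F1 0 - F1 (- T)"
  proof (rule integral_FTC_atLeastAtMost[OF _ _ c1])
    fix t assume t: "- T \<le> t" "t \<le> 0"
    have "(F1 has_field_derivative g1 t) (at t within {- T..0})"
      unfolding F1_def g1_def using pos1[OF t(1)] T x
      by (auto intro!: derivative_eq_intros)
    then show "(F1 has_vector_derivative g1 t) (at t within {- T..0})"
      by (simp add: has_real_derivative_iff_has_vector_derivative)
  qed (use T in simp)
  have 2: "(LINT t|lborel. indicator {0..T} t *\<^sub>R g2 t) = F2 T - F2 0"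
  proof (rule integral_FTC_atLeastAtMost[OF _ _ c2])
    fix t assume t: "0 \<le> t" "t \<le> T"
    have "(F2 has_field_derivative g2 t) (at t within {0..T})"
      unfolding F2_def g2_def using pos2[OF t(2)] T x
      by (auto intro!: derivative_eq_intros)
    then show "(F2 has_vector_derivative g2 t) (at t within {0..T})"
      by (simp add: has_real_derivative_iff_has_vector_derivative)
  qed (use T in simp)
  have [measurable]: "g1 \<in> borel_measurable borel" "g2 \<in> borel_measurable borel"
    unfolding g1_def g2_def by measurable
  have "(LINT t|lborel. 1 - 1 / (1 + x * max 0 (1 - \<bar>t\<bar> / T)))
      = (LINT t|lborel. indicator {- T..0} t *\<^sub>R g1 t + indicator {0..T} t *\<^sub>R g2 t)"
  proof (rule integral_cong_AE)
    \<comment> \<open>Both half intervals contain 0, where the split form counts the kernel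
      twice.\<close>
    have "AE t in lborel. t \<noteq> (0::real)" by (rule AE_lborel_singleton)
    then show "AE t in lborel. 1 - 1 / (1 + x * max 0 (1 - \<bar>t\<bar> / T))
        = indicator {- T..0} t *\<^sub>R g1 t + indicator {0..T} t *\<^sub>R g2 t"
    proof eventually_elim
      case (elim t)
      then show ?case
        using T by (auto simp: indicator_def g1_def g2_def max_def abs_if divide_simps)
    qed
  qed measurable
  also have "\<dots> = (F1 0 - F1 (- T)) + (F2 T - F2 0)"
    unfolding 1[symmetric] 2[symmetric]
    using borel_integrable_atLeastAtMost'[OF c1] borel_integrable_atLeastAtMost'[OF c2]
    by (intro Bochner_Integration.integral_add) (auto simp: set_integrable_def)
  also have "\<dots> = 2 * T * (1 + 1 / x * ln (1 / (1 + x)))"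
    using T x by (simp add: F1_def F2_def ln_div field_simps)
  finally show ?thesis .
qed

section \<open>The interference exponent\<close>

lemma sets_homogeneous_intensity[simp]: "sets (homogeneous_intensity S d) = sets borel"
  by (simp add: homogeneous_intensity_def)

lemma integral_homogeneous_intensity:
  fixes f :: "'a::euclidean_space \<Rightarrow> real"
  assumes [measurable]: "S \<in> sets borel" "f \<in> borel_measurable borel" and c: "0 \<le> c"
  shows "(LINT x|homogeneous_intensity S c. f x) = c * (LINT x|lborel. indicator S x * f x)"
proof -
  have "homogeneous_intensity S c = density lborel (\<lambda>x. ennreal (c * indicator S x))"
    unfolding homogeneous_intensity_def by (simp add: ennreal_mult'[OF c] ennreal_indicator)
  then have "(LINT x|homogeneous_intensity S c. f x) = (LINT x|lborel. (c * indicator S x) *\<^sub>R f x)"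
    using c by (simp only:) (rule integral_density, auto)
  then show ?thesis by (simp add: mult.assoc)
qed

text \<open>Only packets started within \<open>T\<close> of time 0 can meet the reference interval.
  Finite intensity of this slab yields almost surely finitely many of them.\<close>

lemma homogeneous_intensity_time_slab:
  fixes S :: "'a::euclidean_space set"
  assumes S: "closed S" "bounded S"
  shows "emeasure (homogeneous_intensity (S \<times> (UNIV :: real set)) d) {x. \<bar>snd x\<bar> \<le> T} < \<infinity>"
proof -
  have [measurable]: "S \<times> (UNIV :: real set) \<in> sets borel"
    using S by (intro borel_closed closed_Times) auto
  have A[measurable]: "{x :: 'a \<times> real. \<bar>snd x\<bar> \<le> T} \<in> sets borel"
    by (intro borel_closed closed_Collect_le continuous_intros)
  have "emeasure (homogeneous_intensity (S \<times> (UNIV :: real set)) d) {x. \<bar>snd x\<bar> \<le> T}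
      = (\<integral>\<^sup>+ x. ennreal d * indicator ((S \<times> UNIV) \<inter> {x. \<bar>snd x\<bar> \<le> T}) x \<partial>lborel)"
    unfolding homogeneous_intensity_def
    by (subst emeasure_density) (auto intro!: nn_integral_cong simp: indicator_def)
  also have "\<dots> = ennreal d * emeasure lborel ((S \<times> UNIV) \<inter> {x. \<bar>snd x\<bar> \<le> T})"
    by (intro nn_integral_cmult_indicator) auto
  also have "\<dots> < \<infinity>"
  proof -
    have "bounded (S \<times> {- T..T})" using S by (intro bounded_Times) auto
    then have "bounded ((S \<times> UNIV) \<inter> {x. \<bar>snd x\<bar> \<le> T})"
      by (rule bounded_subset) auto
    then show ?thesis
      using emeasure_bounded_finite by (auto simp: ennreal_mult_less_top)
  qed
  finally show ?thesis .
qed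

lemma ring_closed: "closed (ring net s n)"
  unfolding ring_def by (intro closed_Collect_conj closed_Collect_le continuous_intros)

lemma ring_bounded: "bounded (ring net s n)"
  by (rule bounded_subset[OF bounded_cball[of "gw_pos net n" "ring_radius net s"]])
     (auto simp: ring_def dist_commute)

lemma Q_nonneg: "0 \<le> edge_power net s \<Longrightarrow> 0 \<le> path_const net \<Longrightarrow> 0 \<le> Q net s m r \<psi>"
  unfolding Q_def by simp

text \<open>\<open>Q\<close> sees the angle only through the distance to the origin. A polar angle
  in [0, 2 pi] can thus be matched with \<open>user_angle\<close>, an arccos with values in [0, pi],
  by comparing distances instead of angles.\<close>

lemma Q_eq_of_norm:
  assumes "(norm w)\<^sup>2 = (tier_dist net m)\<^sup>2 + r\<^sup>2 - 2 * r * tier_dist net m * cos \<psi>"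
  shows "Q net s m r \<psi> = edge_power net s * path_const net *
     (((gw_height net)\<^sup>2 + r\<^sup>2) / (((gw_height net)\<^sup>2 + (ring_radius net s)\<^sup>2) * ((gw_height net)\<^sup>2 + (norm w)\<^sup>2)))
       powr (path_exp net / 2)"
  unfolding Q_def assms by (simp add: algebra_simps)

text \<open>As transmit power times gain, the received power is built from norms and powers, and the
  arccos disappears.\<close>

lemma Q_user_measurable:
  assumes "0 < gw_height net" "norm (gw_pos net n) = tier_dist net m"
  shows "(\<lambda>w. Q net s m (dist w (gw_pos net n)) (user_angle net n w)) \<in> borel_measurable borel"
  unfolding Q_eq_received_power[OF assms] tx_power_def avg_gain_def by measurable

lemma Q_user_pos:
  assumes "0 < gw_height net" "norm (gw_pos net n) = tier_dist net m"
    and "0 < edge_power net s" "0 < path_const net"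
  shows "0 < Q net s m (dist w (gw_pos net n)) (user_angle net n w)"
proof -
  have "(gw_height net)\<^sup>2 + x\<^sup>2 \<noteq> 0" for x
    using assms(1) by (simp add: sum_power2_eq_zero_iff)
  then show ?thesis
    unfolding Q_eq_received_power[OF assms(1,2)] tx_power_def avg_gain_def
    using assms(1,3,4) by (intro mult_pos_pos) (simp_all add: powr_gt_zero)
qed

text \<open>Once the polar frame of a gateway is turned towards the origin, the law of cosines gives
  the same distance to the origin for every gateway of the tier. This is why the value does not
  depend on \<open>n\<close>.\<close>

lemma E_eq_ring_integral:
  assumes H: "0 < gw_height net" and D: "norm (gw_pos net n) = tier_dist net m"
    and P: "0 < edge_power net s" "0 < path_const net"
    and r: "0 \<le> ring_radius net (s - 1)" and z: "0 < z"
  defines "q \<equiv> \<lambda>w. Q net s m (dist w (gw_pos net n)) (user_angle net n w)"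
  shows "(LINT w|lborel. indicator (ring net s n) w * (1 + 1 / (z * q w) * ln (1 / (1 + z * q w))))
       = E net s m z"
proof -
  define c where "c = gw_pos net n"
  define g where "g w = 1 + 1 / (z * q w) * ln (1 / (1 + z * q w))" for w
  have [measurable]: "q \<in> borel_measurable borel"
    unfolding q_def by (rule Q_user_measurable[OF H D])
  have gm: "g \<in> borel_measurable borel" unfolding g_def by measurable
  \<comment> \<open>The integrand is 1 - ln(1 + x)/x with x > 0, and 0 \<le> ln(1 + x) \<le> x; this
    supplies the bound required for polar coordinates.\<close>
  have gb: "\<bar>g w\<bar> \<le> 1" for w
  proof -
    define x where "x = z * q w"
    have x: "0 < x" using Q_user_pos[OF H D P] z by (simp add: x_def q_def)
    have "ln (1 + x) \<le> x" "0 \<le> ln (1 + x)" using x by (auto intro: ln_add_one_self_le_self)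
    then have "0 \<le> ln (1 + x) / x" "ln (1 + x) / x \<le> 1" using x by auto
    then show ?thesis
      using x by (simp add: g_def ln_div flip: x_def)
  qed
  \<comment> \<open>The gateway sits at -D (cos \<alpha>, sin \<alpha>), where D is the tier
    distance, so the direction (cos \<alpha>, sin \<alpha>) leads from it to the origin.\<close>
  obtain \<alpha> where \<alpha>: "c $ 1 = - (tier_dist net m * cos \<alpha>)" "c $ 2 = - (tier_dist net m * sin \<alpha>)"
  proof -
    have c2: "(c $ 1)\<^sup>2 + (c $ 2)\<^sup>2 = (tier_dist net m)\<^sup>2"
      unfolding D[symmetric] c_def norm_vec_def L2_set_def by (simp add: sum_2)
    show ?thesis
    proof (cases "tier_dist net m = 0")
      case True
      with c2 that[of 0] show ?thesis by simp
    next
      case False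
      then have "(- c $ 1 / tier_dist net m)\<^sup>2 + (- c $ 2 / tier_dist net m)\<^sup>2 = 1"
        using c2 by (simp add: power_divide flip: add_divide_distrib)
      then obtain t where "- c $ 1 / tier_dist net m = cos t" "- c $ 2 / tier_dist net m = sin t"
        by (rule sincos_total_2pi)
      with False that[of t] show ?thesis by (simp add: field_simps)
    qed
  qed
  define p where "p r \<psi> = c + (r * cos (\<psi> + \<alpha>)) *\<^sub>R axis 1 1 + (r * sin (\<psi> + \<alpha>)) *\<^sub>R axis 2 1"
    for r \<psi>
  have qp: "q (p r \<psi>) = Q net s m r \<psi>" if "0 \<le> r" for r \<psi>
  proof -
    have norm2: "(norm w)\<^sup>2 = (w $ 1)\<^sup>2 + (w $ 2)\<^sup>2" for w :: "real ^ 2"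
      by (simp add: norm_vec_def L2_set_def sum_2)
    have "(dist (p r \<psi>) c)\<^sup>2 = r\<^sup>2"
      unfolding dist_norm norm2
      by (simp add: p_def axis_def power_mult_distrib flip: distrib_left)
    then have dist: "dist (p r \<psi>) c = r" using that by (simp add: power2_eq_iff_nonneg)
    have comp: "p r \<psi> $ 1 = r * cos (\<psi> + \<alpha>) - tier_dist net m * cos \<alpha>"
      "p r \<psi> $ 2 = r * sin (\<psi> + \<alpha>) - tier_dist net m * sin \<alpha>"
      using \<alpha> by (simp_all add: p_def axis_def)
    \<comment> \<open>The law of cosines in the turned frame: \<alpha> cancels through the addition
      theorem for the cosine.\<close>
    have "(norm (p r \<psi>))\<^sup>2 = (tier_dist net m)\<^sup>2 * ((sin \<alpha>)\<^sup>2 + (cos \<alpha>)\<^sup>2)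
        + r\<^sup>2 * ((sin (\<psi> + \<alpha>))\<^sup>2 + (cos (\<psi> + \<alpha>))\<^sup>2)
        - 2 * r * tier_dist net m * (cos (\<psi> + \<alpha>) * cos \<alpha> + sin (\<psi> + \<alpha>) * sin \<alpha>)"
      unfolding norm2 comp by algebra
    also have "cos (\<psi> + \<alpha>) * cos \<alpha> + sin (\<psi> + \<alpha>) * sin \<alpha> = cos \<psi>"
      using cos_diff[of "\<psi> + \<alpha>" \<alpha>] by simp
    finally have norm: "(norm (p r \<psi>))\<^sup>2 = (tier_dist net m)\<^sup>2 + r\<^sup>2 - 2 * r * tier_dist net m * cos \<psi>"
      by simp
    show ?thesis
      unfolding q_def Q_eq_of_norm[OF norm_eq_law_of_cosines[OF D]] Q_eq_of_norm[OF norm]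
      by (simp add: dist[unfolded c_def])
  qed
  have "(LINT w|lborel. indicator (ring net s n) w * g w)
      = (LBINT \<psi>:{0..2 * pi}. LBINT r:{ring_radius net (s - 1)..ring_radius net s}. g (p r \<psi>) * r)"
    unfolding ring_def p_def c_def by (rule integral_annulus_polar[OF gm gb r])
  also have "\<dots> = E net s m z"
    unfolding E_def
  proof (rule set_lebesgue_integral_cong)
    show "\<forall>\<psi>. \<psi> \<in> {0..2 * pi} \<longrightarrow> (LBINT r:{ring_radius net (s - 1)..ring_radius net s}. g (p r \<psi>) * r)
      = (LBINT r:{ring_radius net (s - 1)..ring_radius net s}.
          (1 + 1 / (z * Q net s m r \<psi>) * ln (1 / (1 + z * Q net s m r \<psi>))) * r)"
      using r by (intro allI impI set_lebesgue_integral_cong) (auto simp: g_def qp)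
  qed simp
  finally show ?thesis by (simp add: g_def)
qed

lemma poisson_rain_exponent:
  assumes H: "0 < gw_height net" and D: "norm (gw_pos net n) = tier_dist net m"
    and P: "0 < edge_power net s" "0 < path_const net"
    and r: "0 \<le> ring_radius net (s - 1)" and z: "0 < z" and T: "0 < T" and d: "0 \<le> d"
  defines "q \<equiv> \<lambda>w. Q net s m (dist w (gw_pos net n)) (user_angle net n w)"
  shows "(LINT x|homogeneous_intensity (ring net s n \<times> UNIV) d.
            1 - exp (- ln (1 + z * q (fst x) * overlap T (snd x)))) = d * (2 * T * E net s m z)"
proof -
  have [measurable]: "q \<in> borel_measurable borel"
    unfolding q_def by (rule Q_user_measurable[OF H D])
  have q: "0 < z * q w" for w using Q_user_pos[OF H D P] z by (simp add: q_def)
  define f where "f w t = 1 - 1 / (1 + z * q w * overlap T t)" for w t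
  have pos: "0 < 1 + z * q w * overlap T t" for w t
    using q[of w] overlap_nonneg[of T t] by (simp add: add_pos_nonneg)
  have exp_f: "1 - exp (- ln (1 + z * q w * overlap T t)) = f w t" for w t
    using pos by (simp add: f_def exp_minus inverse_eq_divide)
  \<comment> \<open>Without overlap the kernel is 0, so the integrand lives on the bounded set of
    ring points and start times in [-T, T]; this gives the integrability needed for Fubini.\<close>
  have f_bound: "\<bar>f w t\<bar> \<le> indicator {- T..T} t" for w t
  proof (cases "t \<in> {- T..T}")
    case True
    define y where "y = z * q w * overlap T t"
    have "0 \<le> y" unfolding y_def using q[of w] overlap_nonneg[of T t] by simp
    then have "\<bar>1 - 1 / (1 + y)\<bar> \<le> 1" by (simp add: field_simps)
    then show ?thesis using True by (simp add: f_def y_def)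
  next
    case False
    then have "overlap T t = 0" by (intro overlap_eq_0 T) auto
    then show ?thesis by (simp add: f_def)
  qed
  have f_out: "f w t = 0" if "t \<notin> {- T..T}" for w t
    using f_bound[of w t] that by simp
  have [measurable]: "(\<lambda>x. f (fst x) (snd x)) \<in> borel_measurable borel"
    unfolding f_def borel_prod[symmetric] by measurable
  have box: "(ring net s n \<times> UNIV :: ((real ^ 2) \<times> real) set) \<in> sets borel"
    using ring_closed by (intro borel_closed closed_Times) auto
  have "(LINT x|homogeneous_intensity (ring net s n \<times> UNIV) d.
            1 - exp (- ln (1 + z * q (fst x) * overlap T (snd x))))
      = d * (LINT x|lborel. indicator (ring net s n \<times> UNIV) x * f (fst x) (snd x))"
    unfolding exp_f using box d by (intro integral_homogeneous_intensity) auto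
  also have "(LINT x|lborel. indicator (ring net s n \<times> UNIV) x * f (fst x) (snd x))
      = (LINT x|(lborel \<Otimes>\<^sub>M lborel). case_prod (\<lambda>w t. indicator (ring net s n) w * f w t) x)"
    unfolding lborel_prod
    by (intro Bochner_Integration.integral_cong) (auto simp: indicator_def split: prod.splits)
  also have "\<dots> = (LINT w|lborel. LINT t|lborel. indicator (ring net s n) w * f w t)"
  proof (rule lborel_pair.integral_fst[symmetric])
    have "bounded (ring net s n \<times> {- T..T})" using ring_bounded by (intro bounded_Times) auto
    moreover have "ring net s n \<times> {- T..T} \<in> sets borel"
      using ring_closed by (intro borel_closed closed_Times) auto
    ultimately have "set_integrable lborel (ring net s n \<times> {- T..T}) (\<lambda>x. f (fst x) (snd x))"
      using f_bound by (intro set_integrable_bounded_set[where B = 1])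
        (auto intro: order_trans[OF _ indicator_le_1])
    then have "integrable lborel (\<lambda>x. indicator (ring net s n \<times> {- T..T}) x * f (fst x) (snd x))"
      by (simp add: set_integrable_def)
    also have "(\<lambda>x. indicator (ring net s n \<times> {- T..T}) x * f (fst x) (snd x))
        = case_prod (\<lambda>w t. indicator (ring net s n) w * f w t)"
    proof
      fix x show "indicator (ring net s n \<times> {- T..T}) x * f (fst x) (snd x)
          = case_prod (\<lambda>w t. indicator (ring net s n) w * f w t) x"
        using f_out by (cases x) (auto simp: indicator_def)
    qed
    finally show "integrable (lborel \<Otimes>\<^sub>M lborel) (case_prod (\<lambda>w t. indicator (ring net s n) w * f w t))"
      unfolding lborel_prod .
  qed
  also have "\<dots> = (LINT w|lborel. 2 * T * (indicator (ring net s n) w * (1 + 1 / (z * q w) * ln (1 / (1 + z * q w)))))"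
  proof (rule Bochner_Integration.integral_cong[OF refl])
    fix w
    have "(LINT t|lborel. f w t) = 2 * T * (1 + 1 / (z * q w) * ln (1 / (1 + z * q w)))"
      unfolding f_def overlap_def by (rule triangle_kernel_integral[OF T q])
    then show "(LINT t|lborel. indicator (ring net s n) w * f w t)
        = 2 * T * (indicator (ring net s n) w * (1 + 1 / (z * q w) * ln (1 / (1 + z * q w))))"
      by (simp only: integral_mult_right_zero mult.left_commute)
  qed
  also have "\<dots> = 2 * T * E net s m z"
    unfolding q_def E_eq_ring_integral[OF H D P r z, symmetric] by (rule integral_mult_right_zero)
  finally show ?thesis .
qed

section \<open>Laplace transform of the averaged interference\<close>

theorem proposition2:
  fixes M :: "'w measure" and net :: "'g network" and s m :: nat and z :: real
    and N :: "'g \<Rightarrow> 'w \<Rightarrow> enat"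
    and X :: "'g \<Rightarrow> nat \<Rightarrow> 'w \<Rightarrow> (real ^ 2) \<times> real"
    and \<zeta> :: "'g \<Rightarrow> nat \<Rightarrow> 'w \<Rightarrow> real"
  assumes "prob_space M"
    and "0 < gw_height net"
    and "0 < path_const net" and "2 \<le> path_exp net"
    and "0 < user_density net"
    and "1 \<le> s"
    and "0 \<le> ring_radius net (s - 1)" and "ring_radius net (s - 1) < ring_radius net s"
    and "0 < edge_power net s"
    and "0 < packet_time net s"
    and "0 \<le> duty_cycle net s" and "duty_cycle net s < 1"
    and "m \<in> {1..num_tiers net}"
    and "finite (tier net m)"
    and "0 < tier_dist net m"
    and "\<And>n. n \<in> tier net m \<Longrightarrow> norm (gw_pos net n) = tier_dist net m"
    and "poisson_rain M net s m N X \<zeta>"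
    and "0 < z"
  shows "laplace_transform M (avg_interference net s m N X \<zeta>) z
           = exp (- (2 * user_density net * duty_cycle net s * real (card (tier net m)) * E net s m z
                      / (1 - duty_cycle net s)))"
proof -
  note H = assms(2) and P = assms(9,3) and z = assms(18)
  interpret prob_space M by (rule assms(1))
  define I where "I = tier net m"
  define T where "T = packet_time net s"
  define d where "d = user_density net * access_rate net s"
  define \<Lambda> where "\<Lambda> n = homogeneous_intensity (ring net s n \<times> (UNIV :: real set)) d" for n
  define q where "q n w = Q net s m (dist w (gw_pos net n)) (user_angle net n w)" for n w
  define U where "U \<omega> = (\<lambda>n\<in>I. (N n \<omega>, \<lambda>k. X n k \<omega>))" for \<omega>
  define S where "S = PiM I (\<lambda>_. count_space (UNIV :: enat set) \<Otimes>\<^sub>M PiM (UNIV :: nat set) (\<lambda>_. borel :: ((real ^ 2) \<times> real) measure))"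
  \<comment> \<open>The weights are functions on the space of enumerations, so that the independence
    of the marks from \<open>U\<close> applies to them. Indices that are not points get weight
    0.\<close>
  define c where "c n k u = (if enat k < fst (u n)
      then z * q n (fst (snd (u n) k)) * overlap T (snd (snd (u n) k)) else 0)"
    for n k and u :: "'g \<Rightarrow> enat \<times> (nat \<Rightarrow> (real ^ 2) \<times> real)"
  \<comment> \<open>Chosen so that exp(-\<phi>) is the factor 1/(1 + c) left by an integrated
    mark.\<close>
  define \<phi> where "\<phi> n x = ln (1 + z * q n (fst x) * overlap T (snd x))" for n and x :: "(real ^ 2) \<times> real"
  define A where "A = {x :: (real ^ 2) \<times> real. \<bar>snd x\<bar> \<le> T}"
  have I: "finite I" using assms(14) by (simp add: I_def)
  have D: "norm (gw_pos net n) = tier_dist net m" if "n \<in> I" for n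
    using assms(16) that by (simp add: I_def)
  have T: "0 < T" using assms(10) by (simp add: T_def)
  have d: "0 \<le> d" using assms(5,10-12) by (simp add: d_def access_rate_def)
  have ppp: "poisson_point_process M (\<Lambda> n) (N n) (X n)" if "n \<in> I" for n
    using assms(17) that by (simp add: poisson_rain_def I_def \<Lambda>_def d_def)
  have sets_\<Lambda>: "sets (\<Lambda> n) = sets borel" for n
    unfolding \<Lambda>_def by (rule sets_homogeneous_intensity)
  have cells: "indep_vars (\<lambda>_. PiM (sets borel) (\<lambda>_. borel))
      (\<lambda>n \<omega>. \<lambda>B\<in>sets borel. point_count (N n) (X n) B \<omega>) I"
    and fading: "\<And>n k. n \<in> I \<Longrightarrow> distributed M lborel (\<zeta> n k) (exponential_density 1)"
      "indep_vars (\<lambda>_. borel) (\<lambda>(n, k). \<zeta> n k) (I \<times> UNIV)"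
    and marks: "indep_set (sets (vimage_algebra (space M) U S))
      (sets (vimage_algebra (space M) (\<lambda>\<omega>. \<lambda>(n, k)\<in>I \<times> UNIV. \<zeta> n k \<omega>) (PiM (I \<times> UNIV) (\<lambda>_. borel))))"
    using assms(17) unfolding poisson_rain_def I_def S_def U_def[abs_def] by auto
  have q_nn: "0 \<le> q n w" for n w
    unfolding q_def using P by (intro Q_nonneg) auto
  have q_meas[measurable]: "q n \<in> borel_measurable borel" if "n \<in> I" for n
    unfolding q_def[abs_def] using that by (intro Q_user_measurable H D)
  have NX[measurable]: "N n \<in> measurable M (count_space UNIV)" "X n k \<in> borel_measurable M" if "n \<in> I" for n k
    using ppp[OF that] by (auto simp: poisson_point_process_def)
  have \<zeta>[measurable]: "\<zeta> n k \<in> borel_measurable M" if "n \<in> I" for n k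
    using distributed_measurable[OF fading(1)[OF that]] by simp
  have fs[measurable]: "fst \<in> borel_measurable (borel :: ((real ^ 2) \<times> real) measure)"
    "snd \<in> borel_measurable (borel :: ((real ^ 2) \<times> real) measure)"
    by (simp_all flip: borel_prod)
  have U: "U \<in> measurable M S"
    unfolding U_def[abs_def] S_def using NX by (intro measurable_restrict measurable_Pair measurable_PiM_single') auto
  have c_meas: "c n k \<in> borel_measurable S" if n: "n \<in> I" for n k
  proof -
    have [measurable]: "(\<lambda>u. u n) \<in> measurable S (count_space UNIV \<Otimes>\<^sub>M PiM UNIV (\<lambda>_. borel))"
      unfolding S_def using n by (rule measurable_component_singleton)
    have [measurable]: "(\<lambda>u. snd (u n) k) \<in> borel_measurable S"
    proof -
      have "(\<lambda>u. snd (u n)) \<in> measurable S (PiM UNIV (\<lambda>_. borel))" by measurable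
      then show ?thesis
        using measurable_component_singleton[of k UNIV "\<lambda>_. borel"] by (rule measurable_compose) simp
    qed
    note q_meas[OF n, measurable]
    show ?thesis unfolding c_def[abs_def] by measurable
  qed
  have c_nn: "0 \<le> c n k u" for n k u
    unfolding c_def using z q_nn overlap_nonneg by simp
  have slab: "A \<in> sets borel" "emeasure (\<Lambda> n) A < \<infinity>" for n
    unfolding A_def \<Lambda>_def using homogeneous_intensity_time_slab[OF ring_closed ring_bounded, of net s n d T]
    by (auto intro!: borel_closed closed_Collect_le continuous_intros)
  have fin: "AE \<omega> in M. \<forall>n\<in>I. finitely_many_points (N n) (X n) A \<omega>"
    using slab by (intro AE_finite_allI I AE_finitely_many_points[OF ppp]) auto
  define avg where "avg = avg_interference net s m N X \<zeta>"
  \<comment> \<open>The test for being a point is moved into the weight, which separates it from the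
    test for being on air at time \<open>t\<close>.\<close>
  have avg_eq: "avg \<omega> = 1 / T * (LBINT t:{0..T}. \<Sum>n\<in>I. \<Sum>k. if snd (X n k \<omega>) \<le> t \<and> t < snd (X n k \<omega>) + T
      then (if enat k < N n \<omega> then q n (fst (X n k \<omega>)) * \<zeta> n k \<omega> else 0) else 0)" for \<omega>
  proof -
    have "interference net s m N X \<zeta> t \<omega> = (\<Sum>n\<in>I. \<Sum>k. if snd (X n k \<omega>) \<le> t \<and> t < snd (X n k \<omega>) + T
      then (if enat k < N n \<omega> then q n (fst (X n k \<omega>)) * \<zeta> n k \<omega> else 0) else 0)" for t
      unfolding interference_def I_def T_def q_def Let_def case_prod_beta'
      by (intro sum.cong refl suminf_cong) auto
    then show ?thesis unfolding avg_def avg_interference_def T_def by simp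
  qed
  \<comment> \<open>\<open>M\<close> need not be complete, so the almost sure formula below does not give measurability.\<close>
  have avg_meas: "avg \<in> borel_measurable M"
  proof -
    have m1[measurable]: "(\<lambda>p. snd (X n k (fst p))) \<in> borel_measurable (M \<Otimes>\<^sub>M lborel)"
      "(\<lambda>p. fst (X n k (fst p))) \<in> borel_measurable (M \<Otimes>\<^sub>M lborel)"
      "(\<lambda>p. q n (fst (X n k (fst p)))) \<in> borel_measurable (M \<Otimes>\<^sub>M lborel)"
      "(\<lambda>p. \<zeta> n k (fst p)) \<in> borel_measurable (M \<Otimes>\<^sub>M lborel)"
      "(\<lambda>p. N n (fst p)) \<in> measurable (M \<Otimes>\<^sub>M lborel) (count_space UNIV)" if n: "n \<in> I" for n k
    proof -
      note NX[OF n, measurable] q_meas[OF n, measurable] \<zeta>[OF n, measurable]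
      show "(\<lambda>p. snd (X n k (fst p))) \<in> borel_measurable (M \<Otimes>\<^sub>M lborel)"
        "(\<lambda>p. fst (X n k (fst p))) \<in> borel_measurable (M \<Otimes>\<^sub>M lborel)"
        "(\<lambda>p. q n (fst (X n k (fst p)))) \<in> borel_measurable (M \<Otimes>\<^sub>M lborel)"
        "(\<lambda>p. \<zeta> n k (fst p)) \<in> borel_measurable (M \<Otimes>\<^sub>M lborel)"
        "(\<lambda>p. N n (fst p)) \<in> measurable (M \<Otimes>\<^sub>M lborel) (count_space UNIV)"
        by measurable
    qed
    \<comment> \<open>Joint measurability in outcome and time makes the time integral measurable in
      the outcome.\<close>
    have "(\<lambda>p. \<Sum>n\<in>I. \<Sum>k. if snd (X n k (fst p)) \<le> snd p \<and> snd p < snd (X n k (fst p)) + T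
      then (if enat k < N n (fst p) then q n (fst (X n k (fst p))) * \<zeta> n k (fst p) else 0) else 0)
      \<in> borel_measurable (M \<Otimes>\<^sub>M lborel)"
      by (intro borel_measurable_sum borel_measurable_suminf) measurable
    then show ?thesis
      unfolding avg_eq[abs_def] set_lebesgue_integral_def
      by (intro borel_measurable_times borel_measurable_const lborel.borel_measurable_lebesgue_integral)
         (simp add: case_prod_beta')
  qed
  have avg_series: "AE \<omega> in M. z * avg \<omega> = (\<Sum>n\<in>I. \<Sum>k. c n k (U \<omega>) * \<zeta> n k \<omega>)"
    using fin
  proof eventually_elim
    case (elim \<omega>)
    define a where "a n k = (if enat k < N n \<omega> then q n (fst (X n k \<omega>)) * \<zeta> n k \<omega> else 0)" for n k
    define K where "K n = {k. enat k < N n \<omega> \<and> X n k \<omega> \<in> A}" for n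
    have K: "finite (K n)" if "n \<in> I" for n
      using elim that by (simp add: K_def finitely_many_points_def)
    have out: "a n k = 0 \<or> T < \<bar>snd (X n k \<omega>)\<bar>" if "k \<notin> K n" for n k
      using that by (auto simp: a_def K_def A_def)
    have "avg \<omega> = (\<Sum>n\<in>I. \<Sum>k. a n k * overlap T (snd (X n k \<omega>)))"
      unfolding avg_eq a_def[symmetric] by (rule packet_time_average[OF T I K out])
    also have "z * \<dots> = (\<Sum>n\<in>I. z * (\<Sum>k. a n k * overlap T (snd (X n k \<omega>))))"
      by (rule sum_distrib_left)
    also have "\<dots> = (\<Sum>n\<in>I. \<Sum>k. c n k (U \<omega>) * \<zeta> n k \<omega>)"
    proof (rule sum.cong[OF refl])
      fix n assume n: "n \<in> I"
      have "summable (\<lambda>k. a n k * overlap T (snd (X n k \<omega>)))"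
        using out overlap_eq_0[OF T] by (intro summable_finite[OF K[OF n]]) force
      then have "z * (\<Sum>k. a n k * overlap T (snd (X n k \<omega>)))
          = (\<Sum>k. z * (a n k * overlap T (snd (X n k \<omega>))))"
        by (rule suminf_mult[symmetric])
      also have "\<dots> = (\<Sum>k. c n k (U \<omega>) * \<zeta> n k \<omega>)"
        using n by (intro suminf_cong) (simp add: a_def c_def U_def)
      finally show "z * (\<Sum>k. a n k * overlap T (snd (X n k \<omega>))) = (\<Sum>k. c n k (U \<omega>) * \<zeta> n k \<omega>)" .
    qed
    finally show ?case .
  qed
  have cU_meas[measurable]: "(\<lambda>\<omega>. c n k (U \<omega>)) \<in> borel_measurable M" if "n \<in> I" for n k
    using measurable_compose[OF U c_meas[OF that]] .
  have "laplace_transform M avg z = (LINT \<omega>|M. exp (- (\<Sum>n\<in>I. \<Sum>k. c n k (U \<omega>) * \<zeta> n k \<omega>)))"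
    unfolding laplace_transform_def
  proof (rule integral_cong_AE)
    show "(\<lambda>\<omega>. exp (- z * avg \<omega>)) \<in> borel_measurable M" using avg_meas by measurable
    show "AE \<omega> in M. exp (- z * avg \<omega>) = exp (- (\<Sum>n\<in>I. \<Sum>k. c n k (U \<omega>) * \<zeta> n k \<omega>))"
      using avg_series by eventually_elim simp
  qed measurable
  also have "\<dots> = (LINT \<omega>|M. exp (- (\<Sum>n\<in>I. \<Sum>k. ln (1 + c n k (U \<omega>)))))"
  proof (rule laplace_marked_series[OF I U marks c_meas c_nn _ fading])
    show "AE \<omega> in M. \<forall>n\<in>I. finite {k. c n k (U \<omega>) \<noteq> 0}"
      using fin
    proof eventually_elim
      case (elim \<omega>)
      show ?case
      proof
        fix n assume n: "n \<in> I"
        have "{k. c n k (U \<omega>) \<noteq> 0} \<subseteq> {k. enat k < N n \<omega> \<and> X n k \<omega> \<in> A}"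
          using n overlap_eq_0[OF T] by (force simp: c_def U_def A_def split: if_splits)
        then show "finite {k. c n k (U \<omega>) \<noteq> 0}"
          using elim n by (auto simp: finitely_many_points_def intro: finite_subset)
      qed
    qed
  qed
  also have "\<dots> = (LINT \<omega>|M. exp (- (\<Sum>n\<in>I. point_sum (N n) (X n) (\<phi> n) \<omega>)))"
  proof -
    \<comment> \<open>At indices that are not points the logarithm is ln 1 = 0, in agreement with
      the default value in \<open>point_sum\<close>.\<close>
    have "ln (1 + c n k (U \<omega>)) = (if enat k < N n \<omega> then \<phi> n (X n k \<omega>) else 0)" if "n \<in> I" for n k \<omega>
      using that by (simp add: c_def \<phi>_def U_def)
    then show ?thesis by (simp add: point_sum_def cong: sum.cong)
  qed
  also have "\<dots> = exp (- (\<Sum>n\<in>I. LINT x|\<Lambda> n. 1 - exp (- \<phi> n x)))"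
  proof (rule laplace_independent_poisson[OF I ppp sets_\<Lambda> cells])
    show "\<phi> n \<in> borel_measurable borel" if n: "n \<in> I" for n
    proof -
      note q_meas[OF n, measurable]
      show ?thesis unfolding \<phi>_def[abs_def] by measurable
    qed
    show "0 \<le> \<phi> n x" for n x
      unfolding \<phi>_def using z q_nn overlap_nonneg by (intro ln_ge_zero) simp
    show "emeasure (\<Lambda> n) {x. \<phi> n x \<noteq> 0} < \<infinity>" for n
    proof -
      \<comment> \<open>Off the slab the overlap is 0 and \<phi> is ln 1.\<close>
      have "\<phi> n x = 0" if "x \<notin> A" for x
        using that overlap_eq_0[OF T, of "snd x"] by (simp add: A_def \<phi>_def)
      then have "emeasure (\<Lambda> n) {x. \<phi> n x \<noteq> 0} \<le> emeasure (\<Lambda> n) A"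
        using slab(1) by (intro emeasure_mono) (auto simp: \<Lambda>_def)
      then show ?thesis using slab(2) by (rule le_less_trans)
    qed
  qed
  also have "(\<Sum>n\<in>I. LINT x|\<Lambda> n. 1 - exp (- \<phi> n x)) = (\<Sum>n\<in>I. d * (2 * T * E net s m z))"
    unfolding \<Lambda>_def \<phi>_def q_def
    by (intro sum.cong refl poisson_rain_exponent H D P assms(7) z T d)
  \<comment> \<open>The \<open>T\<close> from the integral over start times cancels the packet time
    in the denominator of the access rate, and the sum of equal terms over the tier gives its
    cardinality.\<close>
  also have "\<dots> = 2 * user_density net * duty_cycle net s * real (card (tier net m)) * E net s m z
                      / (1 - duty_cycle net s)"
    using T by (simp add: d_def access_rate_def I_def T_def)
  finally show ?thesis unfolding avg_def .
qed

end
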